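(* Two reduced operation sequences $\alpha$ and $\beta$ are equivalent if and only if there is a finite chain $\alpha=\gamma_0,\gamma_1,\dots,\gamma_r=\beta$ of operation sequences in which $\gamma_{i-1}$ and $\gamma_i$ are rise-fall related for each $i=1,\dots,r$.
   Context: Operation sequences: $\sigma[a]$ ($a\ge1$) denotes pushing the top $a$ elements of the input stack, as a block with relative order unchanged, onto the top of a working stack; $\tau[b]$ ($b\ge1$) denotes moving the top $b$ elements of the working stack, as a block with relative order unchanged, onto the top of an output stack; $\sigma=\sigma[1]$, $\tau=\tau[1]$. A well-formed operation sequence is a word $\alpha=\alpha_1\cdots\alpha_m$ in these symbols such that in every prefix the total push size is at least the total pop size, with equality for the whole word; its size $n$ is the total push size. Acting on an input stack containing $1,\dots,n$ with $1$ on top, it produces the permutation read from the final output stack top to bottom. Two well-formed sequences are equivalent if they have the same size and produce the same permutation. $\alpha$ is reduced if every consecutive pair $\alpha_i\alpha_{i+1}$ with $\alpha_i$ a push and $\alpha_{i+1}$ a pop equals $\sigma[1]\tau[1]$. The support of a push (resp. pop) is the set of elements it places on (resp. removes from) the working stack; a push and a pop correspond if their supports intersect. A rise-fall subsequence of $\alpha$ is a pair $(R,F)$ where $R$ is a subword (consecutive positions) of $\alpha$ consisting only of pushes and $F$ is a later subword consisting only of pops, such that the pops corresponding to pushes of $R$ are exactly the pops of $F$ and the pushes corresponding to pops of $F$ are exactly the pushes of $R$ (so $R$ and $F$ have the same total size), and which is minimal: no pair $(R',F')$ with the same properties has $R'$ a proper nonempty subword of $R$ and $F'$ a subword of $F$.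 Two operation sequences are rise-fall related if one is obtained from the other by replacing, for one rise-fall subsequence $(R,F)$, the subword $R$ by some word of pushes and the subword $F$ by some word of pops (leaving all other operations unchanged), in such a way that the produced permutation does not change. *)

theory Defs
  imports Main
begin

datatype op = Push nat | Pop nat

fun is_push :: "op \<Rightarrow> bool" where
  "is_push (Push a) = True" | "is_push (Pop b) = False"

fun is_pop :: "op \<Rightarrow> bool" where
  "is_pop (Push a) = False" | "is_pop (Pop b) = True"

fun push_size :: "op \<Rightarrow> nat" where
  "push_size (Push a) = a" | "push_size (Pop b) = 0"

fun pop_size :: "op \<Rightarrow> nat" where
  "pop_size (Push a) = 0" | "pop_size (Pop b) = b"

fun op_arg :: "op \<Rightarrow> nat" where
  "op_arg (Push a) = a" | "op_arg (Pop b) = b"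

text \<open>States are (input stack, working stack, output stack), each a list with the top first.\<close>
type_synonym state = "nat list \<times> nat list \<times> nat list"

fun opstep :: "op \<Rightarrow> state \<Rightarrow> state" where
  "opstep (Push a) (inp, w, out) = (drop a inp, take a inp @ w, out)"
| "opstep (Pop b) (inp, w, out) = (inp, drop b w, take b w @ out)"

definition run :: "op list \<Rightarrow> state \<Rightarrow> state" where
  "run ops st = fold opstep ops st"

definition op_size :: "op list \<Rightarrow> nat" where
  "op_size \<alpha> = sum_list (map push_size \<alpha>)"

definition well_formed :: "op list \<Rightarrow> bool" where
  "well_formed \<alpha> \<longleftrightarrow>
     (\<forall>x\<in>set \<alpha>. op_arg x \<ge> 1) \<and>
     (\<forall>k\<le>length \<alpha>. sum_list (map pop_size (take k \<alpha>)) \<le> sum_list (map push_size (take k \<alpha>))) \<and>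
     sum_list (map pop_size \<alpha>) = sum_list (map push_size \<alpha>)"

definition init_state :: "op list \<Rightarrow> state" where
  "init_state \<alpha> = ([1..<op_size \<alpha> + 1], [], [])"

definition perm_of :: "op list \<Rightarrow> nat list" where
  "perm_of \<alpha> = snd (snd (run \<alpha> (init_state \<alpha>)))"

definition equivalent :: "op list \<Rightarrow> op list \<Rightarrow> bool" where
  "equivalent \<alpha> \<beta> \<longleftrightarrow> well_formed \<alpha> \<and> well_formed \<beta> \<and>
     op_size \<alpha> = op_size \<beta> \<and> perm_of \<alpha> = perm_of \<beta>"

definition reduced :: "op list \<Rightarrow> bool" where
  "reduced \<alpha> \<longleftrightarrow> (\<forall>i. Suc i < length \<alpha> \<longrightarrow> is_push (\<alpha> ! i) \<longrightarrow> is_pop (\<alpha> ! Suc i) \<longrightarrow>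
      \<alpha> ! i = Push 1 \<and> \<alpha> ! Suc i = Pop 1)"

definition support :: "op list \<Rightarrow> nat \<Rightarrow> nat set" where
  "support \<alpha> q = (case run (take q \<alpha>) (init_state \<alpha>) of (inp, w, out) \<Rightarrow>
      (case \<alpha> ! q of Push a \<Rightarrow> set (take a inp) | Pop b \<Rightarrow> set (take b w)))"

definition corresponds :: "op list \<Rightarrow> nat \<Rightarrow> nat \<Rightarrow> bool" where
  "corresponds \<alpha> p q \<longleftrightarrow> p < length \<alpha> \<and> q < length \<alpha> \<and>
     is_push (\<alpha> ! p) \<and> is_pop (\<alpha> ! q) \<and> support \<alpha> p \<inter> support \<alpha> q \<noteq> {}"

definition rf_pair :: "op list \<Rightarrow> nat \<Rightarrow> nat \<Rightarrow> nat \<Rightarrow> nat \<Rightarrow> bool" where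
  "rf_pair \<alpha> i j k l \<longleftrightarrow> i < j \<and> j \<le> k \<and> k < l \<and> l \<le> length \<alpha> \<and>
     (\<forall>p\<in>{i..<j}. is_push (\<alpha> ! p)) \<and> (\<forall>q\<in>{k..<l}. is_pop (\<alpha> ! q)) \<and>
     {q. \<exists>p\<in>{i..<j}. corresponds \<alpha> p q} = {k..<l} \<and>
     {p. \<exists>q\<in>{k..<l}. corresponds \<alpha> p q} = {i..<j}"

definition rise_fall :: "op list \<Rightarrow> nat \<Rightarrow> nat \<Rightarrow> nat \<Rightarrow> nat \<Rightarrow> bool" where
  "rise_fall \<alpha> i j k l \<longleftrightarrow> rf_pair \<alpha> i j k l \<and>
     \<not> (\<exists>i' j' k' l'. rf_pair \<alpha> i' j' k' l' \<and> i \<le> i' \<and> j' \<le> j \<and> (i', j') \<noteq> (i, j) \<and>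
          k \<le> k' \<and> l' \<le> l)"

definition rf_step :: "op list \<Rightarrow> op list \<Rightarrow> bool" where
  "rf_step \<alpha> \<beta> \<longleftrightarrow> well_formed \<alpha> \<and> well_formed \<beta> \<and> perm_of \<alpha> = perm_of \<beta> \<and>
     (\<exists>i j k l R' F'. rise_fall \<alpha> i j k l \<and>
        (\<forall>x\<in>set R'. is_push x) \<and> (\<forall>x\<in>set F'. is_pop x) \<and>
        \<beta> = take i \<alpha> @ R' @ take (k - j) (drop j \<alpha>) @ F' @ drop l \<alpha>)"

definition rf_related :: "op list \<Rightarrow> op list \<Rightarrow> bool" where
  "rf_related \<alpha> \<beta> \<longleftrightarrow> rf_step \<alpha> \<beta> \<or> rf_step \<beta> \<alpha>"

end

theory Submission
  imports Defs
begin

text \<open>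
  Pushing or popping a block instead of its elements one by one reverses the block. So an operation
  sequence is a Dyck path together with a partition of its rises and of its falls into blocks, and its
  output is \<open>\<rho> \<circ> N \<circ> \<rho>'\<close>, where \<open>N\<close> matches the pop steps with the push steps of the path and \<open>\<rho>\<close>, \<open>\<rho>'\<close> reverse
  the push and pop blocks. For a reduced sequence the path can be read off from the running maxima of the output,
  so equivalent reduced sequences only differ in their blocks.

  If a reversal of blocks moves a given set onto an initial segment that no block boundary delimits, then
  this set determines the block that crosses the end of the segment. It follows that blocks meeting
  several rises or falls are the same for both sequences, and so is everything linked to them by overlapping blocks.
  Hence the first block in which two sequences differ lies in an interval of steps of one
  rise and one fall which is a union of blocks of both sequences. Replacing a minimal such interval of one
  sequence by that of the other makes the common prefix longer.
\<close>

section \<open>Reversal of blocks\<close>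

text \<open>Reducedness serves to fix the Dyck path. The sequences inside a chain need not be
  reduced, so the induction runs over all pairs with the same path and the same permutation. That
  the first difference lies in an interval closed for both sequences comes from a descent: where the
  matching stops being nested, both sequences are cut alike, and going down from there to the first
  difference, shared blocks can be stripped off until a boundary common to both appears. The
  obstacle is that the minimal closed intervals of the two sequences can differ in length. The
  shorter one then has to be planted into the other sequence without changing its output. This
  succeeds because the longer interval must consist of a single push block and a single pop block:
  the matching inside it is itself a reflection, so the two reversals cancel. Inverting
  \<open>\<rho> \<circ> N \<circ> \<rho>'\<close> exchanges pushes and pops, so every fact about
  push blocks also yields one about pop blocks.\<close>

definition is_block :: "nat set \<Rightarrow> nat \<Rightarrow> nat \<Rightarrow> bool" where
  "is_block B l h \<longleftrightarrow> l < h \<and> l \<in> B \<and> h \<in> B \<and> (\<forall>x. l < x \<longrightarrow> x < h \<longrightarrow> x \<notin> B)"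

definition block_rev :: "nat set \<Rightarrow> nat \<Rightarrow> nat" where
  "block_rev B i = (GREATEST b. b \<in> B \<and> b \<le> i) + (LEAST b. b \<in> B \<and> i < b) - 1 - i"

text \<open>With every position from \<open>n\<close> on a boundary, the reversal becomes an
  involution of all natural numbers, and later arguments need no range conditions.\<close>

definition boundary_set :: "nat \<Rightarrow> nat set \<Rightarrow> bool" where
  "boundary_set n B \<longleftrightarrow> 0 \<in> B \<and> {n..} \<subseteq> B"

lemma block_rev_block:
  assumes "is_block B l h" "l \<le> i" "i < h"
  shows "block_rev B i = l + h - 1 - i"
proof -
  have "(GREATEST b. b \<in> B \<and> b \<le> i) = l"
    using assms by (intro Greatest_equality) (auto simp: is_block_def, meson not_le_imp_less order_le_less_trans)
  moreover have "(LEAST b. b \<in> B \<and> i < b) = h"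
    using assms by (intro Least_equality) (auto simp: is_block_def, meson le_less_trans not_le_imp_less)
  ultimately show ?thesis by (simp add: block_rev_def)
qed

lemma ex_block:
  assumes "boundary_set n B"
  obtains l h where "is_block B l h" "l \<le> i" "i < h"
proof -
  define l where "l = (GREATEST b. b \<in> B \<and> b \<le> i)"
  define h where "h = (LEAST b. b \<in> B \<and> i < b)"
  have "0 \<in> B \<and> (0::nat) \<le> i" using assms by (simp add: boundary_set_def)
  then have l: "l \<in> B \<and> l \<le> i" and lm: "\<And>b. b \<in> B \<and> b \<le> i \<Longrightarrow> b \<le> l"
    unfolding l_def by (rule GreatestI_nat[where b = i], simp) (rule Greatest_le_nat[where b = i], auto)
  have "max n (Suc i) \<in> B \<and> i < max n (Suc i)" using assms by (auto simp: boundary_set_def)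
  then have h: "h \<in> B \<and> i < h" and hm: "\<And>b. b \<in> B \<and> i < b \<Longrightarrow> h \<le> b"
    unfolding h_def by (rule LeastI) (rule Least_le)
  have "is_block B l h" unfolding is_block_def
    using l h lm hm by (metis le_less_trans linorder_not_le)
  with l h that show ?thesis by blast
qed

lemma block_rev_in_block:
  assumes "is_block B l h" "l \<le> i" "i < h"
  shows "l \<le> block_rev B i \<and> block_rev B i < h"
  using assms block_rev_block[OF assms] by auto

lemma block_rev_invol:
  assumes "boundary_set n B"
  shows "block_rev B (block_rev B i) = i"
proof -
  obtain l h where b: "is_block B l h" "l \<le> i" "i < h" by (rule ex_block[OF assms])
  show ?thesis
    using block_rev_block[OF b] block_rev_block[OF b(1)] block_rev_in_block[OF b] b by auto
qed

lemma block_rev_inject: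
  assumes "boundary_set n B"
  shows "block_rev B i = block_rev B j \<longleftrightarrow> i = j"
  using block_rev_invol[OF assms] by metis

section \<open>Which elements a reversal moves below a given position\<close>

lemma block_rev_less_iff:
  assumes "boundary_set n B" "s \<in> B"
  shows "block_rev B i < s \<longleftrightarrow> i < s"
proof -
  obtain l h where b: "is_block B l h" "l \<le> i" "i < h" by (rule ex_block[OF assms(1)])
  show ?thesis using block_rev_in_block[OF b] b assms(2)
    unfolding is_block_def by (metis le_less_trans less_le_trans not_le)
qed

text \<open>The part \<open>[l,s)\<close> of the crossing block is the image of its mirror image
  \<open>[h+l-s,h)\<close>. The bound is written as a sum to avoid truncated subtraction.\<close>

lemma block_rev_less_iff_crossing:
  assumes "boundary_set n B" "is_block B l h" "l < s" "s < h"
  shows "block_rev B i < s \<longleftrightarrow> i < l \<or> h + l \<le> i + s \<and> i < h"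
proof -
  have lh: "l \<in> B" "h \<in> B" using assms by (auto simp: is_block_def)
  consider "i < l" | "l \<le> i" "i < h" | "h \<le> i" by linarith
  then show ?thesis
  proof cases
    case 1 then show ?thesis using block_rev_less_iff[OF assms(1) lh(1), of i] assms by auto
  next
    case 2 then show ?thesis using block_rev_block[OF assms(2) 2] assms by auto
  next
    case 3 then show ?thesis using block_rev_less_iff[OF assms(1) lh(2), of i] assms by auto
  qed
qed

lemma crossing_block:
  assumes "boundary_set n B" "s \<notin> B"
  obtains l h where "is_block B l h" "l < s" "s < h"
proof -
  obtain l h where b: "is_block B l h" "l \<le> s" "s < h" by (rule ex_block[OF assms(1)])
  moreover have "l \<noteq> s" using b assms(2) by (auto simp: is_block_def)
  ultimately show ?thesis using that by auto
qed

text \<open>Reversal is local: a block of \<open>B\<close> meeting \<open>[l,h)\<close> cannot leave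
  it, as both ends are boundaries, so it is a block of \<open>B'\<close> as well.\<close>

lemma block_rev_cong:
  assumes "boundary_set n B" "l \<in> B" "h \<in> B" "\<And>x. l \<le> x \<Longrightarrow> x \<le> h \<Longrightarrow> x \<in> B \<longleftrightarrow> x \<in> B'"
    "l \<le> i" "i < h"
  shows "block_rev B i = block_rev B' i"
proof -
  obtain l' h' where b: "is_block B l' h'" "l' \<le> i" "i < h'" by (rule ex_block[OF assms(1)])
  have r: "l \<le> l'" "h' \<le> h"
    using b assms(2,3,5,6) unfolding is_block_def by (metis le_less_trans less_le_trans not_le)+
  then have "is_block B' l' h'" using b(1) assms(4) unfolding is_block_def by auto
  then show ?thesis using block_rev_block b by metis
qed

text \<open>The described set has greatest element \<open>h - 1\<close>, and its first gap is at
  \<open>l\<close>; the gap is nonempty because \<open>s < h\<close>. Agreement on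
  \<open>[e,b)\<close> suffices, which matters when two blocks can only be compared inside a nested
  stretch.\<close>

lemma crossing_window_unique:
  fixes l :: nat
  assumes "l < s" "s < h" "l' < s" "s < h'" "e \<le> l" "e \<le> l'" "h \<le> b" "h' \<le> b"
    and eq: "\<And>i. e \<le> i \<Longrightarrow> i < b \<Longrightarrow>
      (i < l \<or> h + l \<le> i + s \<and> i < h) \<longleftrightarrow> (i < l' \<or> h' + l' \<le> i + s \<and> i < h')"
  shows "l = l' \<and> h = h'"
proof -
  obtain k k' where k: "h = Suc k" "h' = Suc k'" using assms by (metis less_imp_Suc_add)
  have "k = k'" using eq[of k] eq[of k'] assms(1-8) k by linarith
  moreover have "l = l'"
    using eq[of l] eq[of l'] assms(1-8) \<open>k = k'\<close> k by linarith
  ultimately show ?thesis using k by simp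
qed

definition same_cut :: "nat set \<Rightarrow> nat set \<Rightarrow> nat \<Rightarrow> bool" where
  "same_cut B B' s \<longleftrightarrow> (\<forall>i. block_rev B i < s \<longleftrightarrow> block_rev B' i < s)"

lemma same_cut_boundary:
  assumes "boundary_set n B" "boundary_set n B'" "s \<in> B" "s \<in> B'"
  shows "same_cut B B' s"
  using assms by (simp add: same_cut_def block_rev_less_iff)

text \<open>If the block \<open>[l,h)\<close> crosses \<open>s\<close>, then \<open>l\<close> is the least element that the reversal does not move
  below \<open>s\<close>, and \<open>h - 1\<close> is the greatest element that it does.\<close>

lemma same_cut_cases:
  assumes "boundary_set n B" "boundary_set n B'" "same_cut B B' s"
  obtains "s \<in> B" "s \<in> B'" | l h where "l < s" "s < h" "is_block B l h" "is_block B' l h"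
proof -
  have one: False if b: "boundary_set n B" "boundary_set n B'" "same_cut B B' s" "s \<in> B" "s \<notin> B'" for B B'
  proof -
    obtain l h where lh: "is_block B' l h" "l < s" "s < h" by (rule crossing_block[OF b(2,5)])
    have "\<not> block_rev B (h - 1) < s" using block_rev_less_iff[OF b(1,4)] lh(3) by simp
    moreover have "block_rev B' (h - 1) = l" using block_rev_block[OF lh(1), of "h - 1"] lh by simp
    ultimately show False using b(3) lh(2) unfolding same_cut_def by metis
  qed
  have sym: "same_cut B' B s" using assms(3) by (simp add: same_cut_def)
  show ?thesis
  proof (cases "s \<in> B \<or> s \<in> B'")
    case True then show ?thesis using one assms sym that by metis
  next
    case False
    obtain l h where lh: "is_block B l h" "l < s" "s < h" using crossing_block[OF assms(1)] False by auto
    obtain l' h' where lh': "is_block B' l' h'" "l' < s" "s < h'" using crossing_block[OF assms(2)] False by auto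
    have eq: "(i < l \<or> h + l \<le> i + s \<and> i < h) \<longleftrightarrow> (i < l' \<or> h' + l' \<le> i + s \<and> i < h')" for i
      using assms(3) block_rev_less_iff_crossing[OF assms(1) lh] block_rev_less_iff_crossing[OF assms(2) lh']
      unfolding same_cut_def by auto
    have "l = l' \<and> h = h'"
      using crossing_window_unique[OF lh(2,3) lh'(2,3), of 0 "max h h'"] eq by simp
    then show ?thesis using that lh lh' by auto
  qed
qed

section \<open>Blocks that respect rises and falls\<close>

lemma decreasing_chain:
  fixes M :: "nat \<Rightarrow> nat"
  assumes "\<And>k. a \<le> k \<Longrightarrow> k < b \<Longrightarrow> M (Suc k) < M k" "a \<le> x" "x \<le> y" "y \<le> b"
  shows "M y + (y - x) \<le> M x"
  using assms(3,4)
proof (induction y rule: dec_induct)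
  case (step k)
  then show ?case using assms(1)[of k] assms(2) by auto
qed simp

text \<open>\<open>Suc i\<close> separates the steps \<open>i\<close> and \<open>i + 1\<close>.
  Along a rise the matched pop steps decrease, and from one rise to the next they increase, so an
  ascent of \<open>M\<close> forces a boundary. With \<open>N\<close> for \<open>M\<close> the same
  notion describes pop blocks and falls.\<close>

definition blocking :: "nat \<Rightarrow> (nat \<Rightarrow> nat) \<Rightarrow> nat set \<Rightarrow> bool" where
  "blocking n M B \<longleftrightarrow> boundary_set n B \<and> (\<forall>i. Suc i \<notin> B \<longrightarrow> M (Suc i) < M i)"

lemma blocking_decreasing:
  assumes "blocking n M B" "is_block B l h" "l \<le> k" "Suc k < h"
  shows "M (Suc k) < M k"
  using assms unfolding blocking_def is_block_def by auto

text \<open>Suppose one reversal moves \<open>i\<close> to some \<open>x \<le> s\<close> and the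
  other to some \<open>y > s\<close>. The two blocks around \<open>i\<close> together cover all
  steps from \<open>x\<close> to \<open>y\<close>, so \<open>M\<close> decreases over this whole
  stretch and gives the two bounds in \<open>sep\<close>; but \<open>x\<close> and \<open>y\<close>
  are both sent back to \<open>i\<close>.\<close>

lemma same_cut_criterion:
  assumes B: "blocking n M B1" "blocking n M B2"
    and dec: "M (Suc s) < M s"
    and sep: "\<And>x y. x \<le> s \<Longrightarrow> s < y \<Longrightarrow> M s \<le> M x \<Longrightarrow> M y \<le> M (Suc s) \<Longrightarrow>
        block_rev B1 x \<noteq> block_rev B2 y \<and> block_rev B2 x \<noteq> block_rev B1 y"
  shows "same_cut B1 B2 (Suc s)"
proof -
  have half: "block_rev B2 i \<le> s"
    if B: "blocking n M B1" "blocking n M B2" and le: "block_rev B1 i \<le> s"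
      and sep: "\<And>x y. x \<le> s \<Longrightarrow> s < y \<Longrightarrow> M s \<le> M x \<Longrightarrow> M y \<le> M (Suc s) \<Longrightarrow>
        block_rev B1 x \<noteq> block_rev B2 y" for B1 B2 i
  proof (rule ccontr)
    assume "\<not> block_rev B2 i \<le> s"
    then have gt: "s < block_rev B2 i" by simp
    have bs: "boundary_set n B1" "boundary_set n B2" using B by (auto simp: blocking_def)
    obtain l h where b: "is_block B1 l h" "l \<le> i" "i < h" by (rule ex_block[OF bs(1)])
    obtain l' h' where b': "is_block B2 l' h'" "l' \<le> i" "i < h'" by (rule ex_block[OF bs(2)])
    let ?x = "block_rev B1 i" and ?y = "block_rev B2 i"
    note x = block_rev_in_block[OF b] and y = block_rev_in_block[OF b']
    have steps: "M (Suc k) < M k" if "?x \<le> k" "k < ?y" for k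
      using that b b' x y blocking_decreasing[OF B(1) b(1), of k] blocking_decreasing[OF B(2) b'(1), of k]
      by (cases "k < i") auto
    have "M s \<le> M ?x" using decreasing_chain[of ?x ?y M ?x s] steps le gt by auto
    moreover have "M ?y \<le> M (Suc s)" using decreasing_chain[of ?x ?y M "Suc s" ?y] steps le gt by auto
    moreover have "block_rev B1 ?x = block_rev B2 ?y" using block_rev_invol bs by metis
    ultimately show False using sep le gt by blast
  qed
  show ?thesis unfolding same_cut_def less_Suc_eq_le
    using half[OF B, of i for i] half[OF B(2,1), of i for i] sep by blast
qed

text \<open>The push steps from \<open>e\<close> to \<open>c - 1\<close> belong to one rise and are matched with consecutive pop steps
  of one fall.\<close>

definition nested :: "(nat \<Rightarrow> nat) \<Rightarrow> nat \<Rightarrow> nat \<Rightarrow> bool" where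
  "nested M e c \<longleftrightarrow> (\<forall>i. e \<le> i \<longrightarrow> i < c \<longrightarrow> M i + (i - e) = M e)"

section \<open>Two partitions of one path with the same output\<close>

locale two_blockings =
  fixes n :: nat and M N :: "nat \<Rightarrow> nat" and B1 B2 C1 C2 :: "nat set"
  assumes MN: "\<And>j. M (N j) = j" and NM: "\<And>i. N (M i) = i"
    and B1: "blocking n M B1" and B2: "blocking n M B2"
    and C1: "blocking n N C1" and C2: "blocking n N C2"
    and same_out: "\<And>j. block_rev B1 (N (block_rev C1 j)) = block_rev B2 (N (block_rev C2 j))"
begin

lemma bounds: "boundary_set n B1" "boundary_set n B2" "boundary_set n C1" "boundary_set n C2"
  using B1 B2 C1 C2 by (auto simp: blocking_def)

lemma same_time: "block_rev C1 (M (block_rev B1 i)) = block_rev C2 (M (block_rev B2 i))"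
proof -
  let ?j = "block_rev C1 (M (block_rev B1 i))"
  have "block_rev B2 (N (block_rev C2 ?j)) = i"
    using same_out[of ?j] block_rev_invol bounds NM by metis
  then show ?thesis using block_rev_invol bounds MN by metis
qed

text \<open>All maps being permutations of the natural numbers, the exchange of pushes and pops
  stays within the same locale.\<close>

lemma dual: "two_blockings n N M C1 C2 B1 B2"
  using MN NM B1 B2 C1 C2 same_time by unfold_locales auto

text \<open>If both sequences push the same element at step \<open>i\<close>, this element is popped
  at step \<open>M i\<close> in both, and its slot in the output is the reversal of
  \<open>M i\<close> for either.\<close>

lemma block_rev_transfer:
  "block_rev B1 i = block_rev B2 i \<longleftrightarrow> block_rev C1 (M i) = block_rev C2 (M i)"
proof
  assume *: "block_rev B1 i = block_rev B2 i"
  show "block_rev C1 (M i) = block_rev C2 (M i)"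
    using same_time[of "block_rev B1 i"] * block_rev_invol bounds by metis
next
  assume *: "block_rev C1 (M i) = block_rev C2 (M i)"
  show "block_rev B1 i = block_rev B2 i"
    using same_out[of "block_rev C1 (M i)"] * block_rev_invol bounds NM by metis
qed

text \<open>A push block can only cross from \<open>s\<close> to \<open>s + 1\<close> with these two steps matched in different
  falls if it does so in both sequences, as the set of elements popped before the second fall is the same.\<close>

lemma same_cut_if_not_nested:
  assumes "M s \<noteq> Suc (M (Suc s))"
  shows "same_cut B1 B2 (Suc s)"
proof (cases "M (Suc s) < M s")
  case False
  then have "Suc s \<in> B1" "Suc s \<in> B2" using B1 B2 by (auto simp: blocking_def)
  then show ?thesis using same_cut_boundary bounds by blast
next
  case True
  \<comment> \<open>Decreasing all the way, \<open>N\<close> would drop by at least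
    \<open>M s - M (Suc s) \<ge> 2\<close>, but it only goes from \<open>Suc s\<close> to
    \<open>s\<close>. An ascent of \<open>N\<close> separates two falls, so it is a boundary for
    both pop partitions.\<close>
  have "\<exists>v. M (Suc s) \<le> v \<and> v < M s \<and> \<not> N (Suc v) < N v"
  proof (rule ccontr)
    assume "\<not> ?thesis"
    then have d: "\<And>v. M (Suc s) \<le> v \<Longrightarrow> v < M s \<Longrightarrow> N (Suc v) < N v" by blast
    have "N (M s) + (M s - M (Suc s)) \<le> N (M (Suc s))"
      using decreasing_chain[of "M (Suc s)" "M s" N "M (Suc s)" "M s"] d True by auto
    then show False using True assms by (simp add: NM)
  qed
  then obtain v where v: "M (Suc s) \<le> v" "v < M s" "Suc v \<in> C1" "Suc v \<in> C2"
    using C1 C2 by (auto simp: blocking_def)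
  show ?thesis
  proof (rule same_cut_criterion[OF B1 B2 True])
    fix x y assume "x \<le> s" "s < y" "M s \<le> M x" "M y \<le> M (Suc s)"
    then have xv: "\<not> M x < Suc v" "M y < Suc v" using v by auto
    then have "block_rev C1 (M x) \<noteq> block_rev C2 (M y)" "block_rev C2 (M x) \<noteq> block_rev C1 (M y)"
      using block_rev_less_iff bounds v by metis+
    then show "block_rev B1 x \<noteq> block_rev B2 y \<and> block_rev B2 x \<noteq> block_rev B1 y"
      using same_time[of "block_rev B1 x"] same_time[of "block_rev B2 x"] block_rev_invol bounds by metis
  qed
qed

text \<open>If \<open>N\<close> ascends after \<open>M e\<close>, the boundary is forced. Otherwise
  the next pop step is matched with a push before \<open>e\<close>, where the push reversals agree;
  this separates the slots and makes the cuts equal. A common block across the cut would contain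
  \<open>M e\<close>, and agreement there transfers to \<open>e\<close>.\<close>

lemma first_difference_closes_fall:
  assumes same: "\<And>i. i < e \<Longrightarrow> block_rev B1 i = block_rev B2 i"
    and diff: "block_rev B1 e \<noteq> block_rev B2 e"
  shows "Suc (M e) \<in> C1 \<and> Suc (M e) \<in> C2"
proof (cases "N (Suc (M e)) < e")
  case False
  then show ?thesis using C1 C2 by (auto simp: blocking_def NM)
next
  case True
  have "same_cut C1 C2 (Suc (M e))"
  proof (rule same_cut_criterion[OF C1 C2])
    show "N (Suc (M e)) < N (M e)" using True by (simp add: NM)
    fix x y assume *: "x \<le> M e" "M e < y" "N (M e) \<le> N x" "N y \<le> N (Suc (M e))"
    then have r: "block_rev B1 (N y) = block_rev B2 (N y)" using True same by simp
    have "N x \<noteq> N y" using * True by (simp add: NM)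
    then have "block_rev B1 (N x) \<noteq> block_rev B1 (N y)" "block_rev B2 (N x) \<noteq> block_rev B2 (N y)"
      using block_rev_inject bounds by blast+
    then show "block_rev C1 x \<noteq> block_rev C2 y \<and> block_rev C2 x \<noteq> block_rev C1 y"
      using r same_out[of "block_rev C1 x"] same_out[of "block_rev C2 x"] block_rev_invol bounds by metis
  qed
  then show ?thesis
  proof (rule same_cut_cases[OF bounds(3,4)])
    fix l h assume *: "l < Suc (M e)" "Suc (M e) < h" "is_block C1 l h" "is_block C2 l h"
    then have "block_rev C1 (M e) = block_rev C2 (M e)"
      using block_rev_block[OF *(3), of "M e"] block_rev_block[OF *(4), of "M e"] by simp
    then show ?thesis using block_rev_transfer diff by blast
  qed auto
qed

lemma common_cut:
  assumes diff: "block_rev B1 e \<noteq> block_rev B2 e"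
  obtains c where "e < c" "nested M e c" "c \<in> B1" "c \<in> B2"
    "Suc (M e) - (c - e) \<in> C1" "Suc (M e) - (c - e) \<in> C2"
proof -
  let ?P = "\<lambda>c. e < c \<and> nested M e c"
  \<comment> \<open>The push steps \<open>e\<close> to \<open>c - 1\<close> are matched with the pop
    steps \<open>M e\<close> down to \<open>?d c\<close>.\<close>
  let ?d = "\<lambda>c. Suc (M e) - (c - e)"
  have "c \<le> e + Suc (M e)" if "?P c" for c
  proof -
    from that have "e \<le> c - 1" "c - 1 < c" by linarith+
    then have "M (c - 1) + (c - 1 - e) = M e" using that unfolding nested_def by blast
    then show ?thesis using that by linarith
  qed
  moreover have "?P (Suc e)" by (auto simp: nested_def le_less_Suc_eq)
  ultimately obtain r where r: "?P r" and rmax: "\<And>c. ?P c \<Longrightarrow> c \<le> r"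
    using GreatestI_nat[of ?P "Suc e" "e + Suc (M e)"] Greatest_le_nat[of ?P _ "e + Suc (M e)"] by blast
  obtain s where s: "r = Suc s" "e \<le> s" using r by (cases r) auto
  have Ms: "M s + (s - e) = M e" using r s unfolding nested_def by auto
  have Mr: "M r + (r - e) \<noteq> M e"
  proof
    assume "M r + (r - e) = M e"
    then have "?P (Suc r)" using r by (auto simp: nested_def less_Suc_eq)
    then show False using rmax by fastforce
  qed
  have baseB: "same_cut B1 B2 r"
    using same_cut_if_not_nested[of s] Ms Mr s by fastforce
  have dr: "?d r = M s" using Ms s by auto
  have baseC: "same_cut C1 C2 (?d r)"
  proof (cases "M s")
    case 0
    then show ?thesis using same_cut_boundary bounds dr by (metis boundary_set_def)
  next
    case (Suc j)
    interpret D: two_blockings n N M C1 C2 B1 B2 by (rule dual)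
    \<comment> \<open>If the nesting continued on the pop side, \<open>j\<close> would be matched
      with \<open>r\<close>, and the maximal stretch could be prolonged.\<close>
    have "N j \<noteq> Suc (N (Suc j))"
    proof
      assume "N j = Suc (N (Suc j))"
      then have "N j = r" using Suc s by (metis NM)
      then have "M r = j" using MN by blast
      then show False using Mr Ms Suc s by auto
    qed
    then show ?thesis using D.same_cut_if_not_nested Suc dr by simp
  qed
  \<comment> \<open>If a cut is not a boundary in all four sets, a shared block crosses it on one
    side. Then the reversals agree at the step just below, and this step can be taken out of the
    comparison. The difference at \<open>e\<close> stops the descent before it reaches
    \<open>e\<close>.\<close>
  have down: "\<exists>c'. e < c' \<and> c' \<le> c \<and> c' \<in> B1 \<and> c' \<in> B2 \<and> ?d c' \<in> C1 \<and> ?d c' \<in> C2"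
    if "e < c" "c \<le> r" "same_cut B1 B2 c" "same_cut C1 C2 (?d c)" for c
    using that
  proof (induction c)
    case (Suc c)
    have Mc: "M c + (c - e) = M e" using r Suc.prems unfolding nested_def by auto
    then have d: "?d (Suc c) = M c" using Suc.prems by auto
    show ?case
    proof (cases "Suc c \<in> B1 \<and> Suc c \<in> B2 \<and> ?d (Suc c) \<in> C1 \<and> ?d (Suc c) \<in> C2")
      case True then show ?thesis using Suc.prems by blast
    next
      case False
      have eqB: "block_rev B1 c = block_rev B2 c"
      proof (cases "Suc c \<in> B1 \<and> Suc c \<in> B2")
        case True
        with False have "\<not> (M c \<in> C1 \<and> M c \<in> C2)" using d by auto
        then obtain l h where *: "l < M c" "M c < h" "is_block C1 l h" "is_block C2 l h"
          using same_cut_cases[OF bounds(3,4) Suc.prems(4)] d by metis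
        then have "block_rev C1 (M c) = block_rev C2 (M c)"
          using block_rev_block[OF *(3), of "M c"] block_rev_block[OF *(4), of "M c"] by simp
        then show ?thesis using block_rev_transfer by blast
      next
        case False
        then obtain l h where *: "l < Suc c" "Suc c < h" "is_block B1 l h" "is_block B2 l h"
          using same_cut_cases[OF bounds(1,2) Suc.prems(3)] by metis
        then show ?thesis
          using block_rev_block[OF *(3), of c] block_rev_block[OF *(4), of c] by simp
      qed
      then have eqC: "block_rev C1 (M c) = block_rev C2 (M c)" using block_rev_transfer by blast
      have ec: "e < c" using diff eqB Suc.prems(1) by (cases "c = e") auto
      \<comment> \<open>The preimage of \<open>c\<close> is common, so it can be removed from the
        cut at \<open>Suc c\<close>. On the pop side the preimage of \<open>M c\<close> is added
        instead, as \<open>?d\<close> grows when \<open>c\<close> shrinks.\<close>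
      have "block_rev B1 i = c \<longleftrightarrow> block_rev B2 i = c" for i
        using eqB block_rev_invol bounds by metis
      then have "same_cut B1 B2 c" using Suc.prems(3) unfolding same_cut_def by (metis less_Suc_eq nat_neq_iff)
      moreover have "block_rev C1 i = M c \<longleftrightarrow> block_rev C2 i = M c" for i
        using eqC block_rev_invol bounds by metis
      then have "same_cut C1 C2 (Suc (M c))" using Suc.prems(4) unfolding same_cut_def d by (metis less_Suc_eq)
      moreover have "?d c = Suc (M c)" using Mc ec by auto
      ultimately show ?thesis using Suc.IH ec Suc.prems(2) by (metis Suc_leD le_SucI)
    qed
  qed simp
  obtain c where "e < c" "c \<le> r" "c \<in> B1" "c \<in> B2" "?d c \<in> C1" "?d c \<in> C2"
    using down[of r] r baseB baseC by blast
  moreover then have "nested M e c" using r unfolding nested_def by auto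
  ultimately show ?thesis using that by blast
qed

text \<open>When the closed interval of the first sequence ends inside a minimal closed interval of the
  second, the blocks of the second that cross this end move the same set of slots, hence coincide.\<close>

lemma smaller_cut_single_block:
  assumes ab: "e < a" "a < b" and nest: "nested M e b"
    and a: "e \<in> B1" "a \<in> B1" "Suc (M e) \<in> C1" "Suc (M e) - (a - e) \<in> C1"
    and b: "e \<in> B2" "b \<in> B2" "Suc (M e) \<in> C2" "Suc (M e) - (b - e) \<in> C2"
    and min: "\<And>c. e < c \<Longrightarrow> c < b \<Longrightarrow> \<not> (c \<in> B2 \<and> Suc (M e) - (c - e) \<in> C2)"
  shows "is_block B2 e b \<and> is_block C2 (Suc (M e) - (b - e)) (Suc (M e))"
proof -
  let ?t = "M e"
  let ?d = "\<lambda>c. Suc ?t - (c - e)"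
  have Mx: "M x = ?t - (x - e)" "x - e \<le> ?t" if "e \<le> x" "x < b" for x
    using nest that unfolding nested_def by (metis diff_add_inverse2, metis le_add2)
  have bt: "b - e \<le> Suc ?t" using Mx(2)[of "b - 1"] ab by linarith
  \<comment> \<open>Here \<open>?i\<close> is the element that the second sequence pushes at step
    \<open>x\<close>, and \<open>?u\<close> is the step at which the first pushes it. The first
    sequence has boundaries at \<open>a\<close> and \<open>?d a\<close>, so elements below
    \<open>a\<close> go to slots from \<open>?d a\<close> on; equal outputs carry this over to the
    second.\<close>
  have key: "block_rev B2 x < a \<longleftrightarrow> \<not> block_rev C2 (M x) < ?d a" if x: "e \<le> x" "x < b" for x
  proof -
    let ?i = "block_rev B2 x" and ?u = "block_rev B1 (block_rev B2 x)"
    have i: "e \<le> ?i" "?i < b" using x b block_rev_less_iff[OF bounds(2)] by (metis not_le)+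
    have t: "block_rev C2 (M x) = block_rev C1 (M ?u)"
      using same_time[of ?i] block_rev_invol bounds by metis
    have u: "?u < a \<longleftrightarrow> ?i < a" "e \<le> ?u" using i a block_rev_less_iff[OF bounds(1)] by (metis not_le)+
    have r: "block_rev C1 (M ?u) < ?d a \<longleftrightarrow> M ?u < ?d a" using a block_rev_less_iff[OF bounds(3)] by blast
    have r': "block_rev C2 (M x) < Suc ?t" "?d b \<le> block_rev C2 (M x)"
      using b block_rev_less_iff[OF bounds(4), of "Suc ?t" "M x"] block_rev_less_iff[OF bounds(4), of "?d b" "M x"]
        Mx[OF x] x ab bt by auto
    show ?thesis
    proof (cases "?i < a")
      case True
      then show ?thesis using Mx[of ?u] u r t ab by auto
    next
      case False
      have "block_rev C1 (M ?u) < Suc ?t" using r' t by simp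
      then have "M ?u < Suc ?t" using a block_rev_less_iff[OF bounds(3)] by blast
      have "M ?u < ?d a"
      proof (rule ccontr)
        assume n: "\<not> M ?u < ?d a"
        \<comment> \<open>The pop steps from \<open>?d a\<close> to \<open>?t\<close> are all
          matched with push steps in \<open>[e,a)\<close>, so \<open>?u\<close> would be one of
          those.\<close>
        let ?w = "e + (?t - M ?u)"
        have w: "e \<le> ?w" "?w < a" using n ab \<open>M ?u < Suc ?t\<close> by auto
        then have "M ?w = M ?u" using Mx[of ?w] ab \<open>M ?u < Suc ?t\<close> by auto
        then have "?w = ?u" by (metis NM)
        then show False using w u False by simp
      qed
      then show ?thesis using False r t by simp
    qed
  qed
  have below: "block_rev C2 y < ?d a \<longleftrightarrow> y < ?d a" if "?d a \<in> C2" for y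
    using block_rev_less_iff[OF bounds(4) that] .
  have da: "?d b < ?d a" "?d a < Suc ?t" using ab bt by linarith+
  \<comment> \<open>If only \<open>a\<close> were a boundary, take the push step matched with the
    last step \<open>h - 1\<close> of the pop block across \<open>?d a\<close>: its element stays
    below \<open>a\<close>, while its slot moves below \<open>?d a\<close>, against
    \<open>key\<close>.\<close>
  have "a \<notin> B2"
  proof
    assume aB: "a \<in> B2"
    then have "?d a \<notin> C2" using min ab by blast
    then obtain l h where lh: "is_block C2 l h" "l < ?d a" "?d a < h" by (rule crossing_block[OF bounds(4)])
    have hT: "h \<le> Suc ?t" using lh b(3) da unfolding is_block_def by (meson less_trans not_le)
    let ?x = "e + (Suc ?t - h)"
    have x: "e \<le> ?x" "?x < a" using lh hT ab da by linarith+
    then have "M ?x = h - 1" using Mx[of ?x] ab lh hT by linarith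
    then have "block_rev C2 (M ?x) = l" using block_rev_block[OF lh(1), of "h - 1"] lh by auto
    then have "\<not> block_rev B2 ?x < a" using key[of ?x] x ab lh by auto
    then show False using block_rev_less_iff[OF bounds(2) aB] x by blast
  qed
  then obtain l h where lh: "is_block B2 l h" "l < a" "a < h" by (rule crossing_block[OF bounds(2)])
  have lh_in: "e \<le> l" "h \<le> b"
    using lh b(1,2) ab unfolding is_block_def by (meson less_trans not_le)+
  have "?d a \<notin> C2"
  proof
    assume aC: "?d a \<in> C2"
    have "block_rev B2 (h - 1) = l" using block_rev_block[OF lh(1), of "h - 1"] lh by auto
    then have "\<not> M (h - 1) < ?d a" using key[of "h - 1"] below[OF aC] lh(2,3) lh_in by auto
    moreover have "M (h - 1) = ?t - (h - 1 - e)" using Mx[of "h - 1"] lh lh_in by auto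
    ultimately show False using lh(2,3) lh_in da bt ab by linarith
  qed
  then obtain l' h' where lh': "is_block C2 l' h'" "l' < ?d a" "?d a < h'" by (rule crossing_block[OF bounds(4)])
  have lh'_in: "?d b \<le> l'" "h' \<le> Suc ?t"
    using lh' b(3,4) da unfolding is_block_def by (meson less_trans not_le)+
  \<comment> \<open>\<open>[?L,?H)\<close> is the pop block \<open>[l',h')\<close> reflected to push
    steps by the nested matching; by \<open>key\<close> it cuts out the same set as
    \<open>[l,h)\<close>.\<close>
  let ?L = "e + (Suc ?t - h')" and ?H = "e + (Suc ?t - l')"
  note ar = lh(2,3) lh'(2,3) lh_in lh'_in da ab bt
  have L: "?L < a" and H: "a < ?H" "?H \<le> b" using ar by linarith+
  have reflect: "h' + ?L = Suc ?t + e" "l' + ?H = Suc ?t + e" "?d a + a = Suc ?t + e" using ar by linarith+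
  have "(x < l \<or> h + l \<le> x + a \<and> x < h) \<longleftrightarrow> (x < ?L \<or> ?H + ?L \<le> x + a \<and> x < ?H)"
    if x: "e \<le> x" "x < b" for x
  proof -
    have "M x + x = ?t + e" using Mx[OF x] x by linarith
    then have "M x < l' \<longleftrightarrow> ?H \<le> x" "M x < h' \<longleftrightarrow> ?L \<le> x" "h' + l' \<le> M x + ?d a \<longleftrightarrow> x + a < ?H + ?L"
      using reflect by (intro iffI; linarith)+
    then have "\<not> (M x < l' \<or> h' + l' \<le> M x + ?d a \<and> M x < h') \<longleftrightarrow>
        (x < ?L \<or> ?H + ?L \<le> x + a \<and> x < ?H)"
      using L H by (metis leD leI less_trans)
    then show ?thesis
      using key[OF x] block_rev_less_iff_crossing[OF bounds(2) lh, of x]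
        block_rev_less_iff_crossing[OF bounds(4) lh', of "M x"] by blast
  qed
  then have "l = ?L \<and> h = ?H"
    using crossing_window_unique[OF lh(2,3) L H(1) lh_in(1) _ lh_in(2) H(2)] by simp
  then have lL: "l = ?L" and hH: "h = ?H" by auto
  have "h' + l = Suc ?t + e" "l' + h = Suc ?t + e" using reflect(1,2) lL hH by metis+
  then have dl: "?d l = h'" and dh: "?d h = l'" using lh_in(1) lh(2,3) by linarith+
  \<comment> \<open>An end strictly inside \<open>[e,b)\<close> would be a boundary together with
    its mirror image, hence a smaller closed interval.\<close>
  have "l = e"
  proof (rule ccontr)
    assume "l \<noteq> e"
    then have "e < l" "l < b" using lh_in ar by auto
    then show False using min[of l] lh(1) lh'(1) dl by (auto simp: is_block_def)
  qed
  moreover have "h = b"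
  proof (rule ccontr)
    assume "h \<noteq> b"
    then have "e < h" "h < b" using lh_in ar by auto
    then show False using min[of h] lh(1) lh'(1) dh by (auto simp: is_block_def)
  qed
  ultimately show ?thesis using lh(1) lh'(1) dl dh by auto
qed

end

section \<open>Operation sequences as partitioned Dyck paths\<close>

abbreviation weight :: "(op \<Rightarrow> nat) \<Rightarrow> op list \<Rightarrow> nat" where
  "weight f xs \<equiv> sum_list (map f xs)"

text \<open>Everything beyond the total weight counts as a boundary, so that \<open>block_rev\<close> is the identity there.\<close>

definition boundaries :: "(op \<Rightarrow> nat) \<Rightarrow> op list \<Rightarrow> nat set" where
  "boundaries f \<alpha> = range (\<lambda>k. weight f (take k \<alpha>)) \<union> {weight f \<alpha>..}"

lemma weight_take_mono: "i \<le> j \<Longrightarrow> weight f (take i \<alpha>) \<le> weight f (take j \<alpha>)"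
  by (metis le_add1 le_add_diff_inverse map_append sum_list_append take_add)

lemma weight_take_le: "weight f (take i \<alpha>) \<le> weight f \<alpha>"
  by (metis append_take_drop_id le_add1 map_append sum_list_append)

lemma weight_take_Suc:
  "k < length \<alpha> \<Longrightarrow> weight f (take (Suc k) \<alpha>) = weight f (take k \<alpha>) + f (\<alpha> ! k)"
  by (simp add: take_Suc_conv_app_nth)

lemma boundary_set_boundaries: "boundary_set (weight f \<alpha>) (boundaries f \<alpha>)"
proof -
  have "weight f (take 0 \<alpha>) \<in> boundaries f \<alpha>" unfolding boundaries_def by blast
  then show ?thesis by (auto simp: boundary_set_def boundaries_def)
qed

lemma weight_take_in_boundaries: "weight f (take k \<alpha>) \<in> boundaries f \<alpha>"
  by (auto simp: boundaries_def)

lemma boundariesE: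
  assumes "x \<in> boundaries f \<alpha>" "x \<le> weight f \<alpha>"
  obtains k where "k \<le> length \<alpha>" "x = weight f (take k \<alpha>)"
proof -
  have "\<exists>k. x = weight f (take k \<alpha>)"
    using assms unfolding boundaries_def by (auto intro: exI[of _ "length \<alpha>"])
  then obtain k where "x = weight f (take k \<alpha>)" by blast
  then show ?thesis using that[of "min k (length \<alpha>)"] by (simp add: min_def split: if_splits)
qed

lemma boundaries_append_le:
  assumes "x \<le> weight f X"
  shows "x \<in> boundaries f (X @ S) \<longleftrightarrow> x \<in> boundaries f X"
proof
  assume "x \<in> boundaries f (X @ S)"
  then obtain k where k: "x = weight f (take k (X @ S))"
    using boundariesE[of x f "X @ S"] assms by auto
  show "x \<in> boundaries f X"
  proof (cases "k \<le> length X")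
    case True then show ?thesis using k weight_take_in_boundaries by simp
  next
    case False
    then have "x = weight f X" using k assms by auto
    then show ?thesis by (simp add: boundaries_def)
  qed
next
  assume "x \<in> boundaries f X"
  then obtain k where k: "k \<le> length X" "x = weight f (take k X)" using boundariesE assms by metis
  then have "x = weight f (take k (X @ S))" by simp
  then show "x \<in> boundaries f (X @ S)" using weight_take_in_boundaries by metis
qed

lemma boundaries_append_add:
  "weight f X + y \<in> boundaries f (X @ S) \<longleftrightarrow> y \<in> boundaries f S"
proof
  assume *: "weight f X + y \<in> boundaries f (X @ S)"
  show "y \<in> boundaries f S"
  proof (cases "y \<le> weight f S")
    case True
    then obtain k where k: "weight f X + y = weight f (take k (X @ S))"
      using boundariesE[OF *] by auto
    show ?thesis
    proof (cases "k \<le> length X")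
      case True
      then have "y = 0" using k weight_take_le[of f k X] by auto
      then show ?thesis using boundary_set_boundaries by (simp add: boundary_set_def)
    next
      case False
      then have "y = weight f (take (k - length X) S)" using k by simp
      then show ?thesis using weight_take_in_boundaries by metis
    qed
  qed (simp add: boundaries_def)
next
  assume *: "y \<in> boundaries f S"
  show "weight f X + y \<in> boundaries f (X @ S)"
  proof (cases "y \<le> weight f S")
    case True
    then obtain k where "y = weight f (take k S)" using boundariesE[OF *] by auto
    then have "weight f X + y = weight f (take (length X + k) (X @ S))" by simp
    then show ?thesis using weight_take_in_boundaries by metis
  qed (simp add: boundaries_def)
qed

lemma is_block_op:
  assumes "k < length \<alpha>" "0 < f (\<alpha> ! k)"
  shows "is_block (boundaries f \<alpha>) (weight f (take k \<alpha>)) (weight f (take (Suc k) \<alpha>))"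
  unfolding is_block_def
proof (intro conjI allI impI)
  show "weight f (take k \<alpha>) < weight f (take (Suc k) \<alpha>)" using assms by (simp add: weight_take_Suc)
  fix x assume x: "weight f (take k \<alpha>) < x" "x < weight f (take (Suc k) \<alpha>)"
  show "x \<notin> boundaries f \<alpha>"
  proof
    assume "x \<in> boundaries f \<alpha>"
    then obtain m where m: "x = weight f (take m \<alpha>)"
      using boundariesE x weight_take_le[of f "Suc k" \<alpha>] by (metis less_le_trans less_imp_le)
    show False
    proof (cases "m \<le> k")
      case True then show ?thesis using weight_take_mono[OF True, of f \<alpha>] x m by simp
    next
      case False then show ?thesis using weight_take_mono[of "Suc k" m f \<alpha>] x m by simp
    qed
  qed
qed (rule weight_take_in_boundaries)+

lemma locate_op:
  assumes "x < weight f \<alpha>"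
  obtains k where "k < length \<alpha>" "weight f (take k \<alpha>) \<le> x" "x < weight f (take (Suc k) \<alpha>)"
proof -
  define m where "m = (LEAST k. x < weight f (take k \<alpha>))"
  have "x < weight f (take (length \<alpha>) \<alpha>)" using assms by simp
  then have m: "x < weight f (take m \<alpha>)" "m \<le> length \<alpha>"
    unfolding m_def by (rule LeastI, intro Least_le) simp
  then obtain k where k: "m = Suc k" by (cases m) auto
  then have "\<not> x < weight f (take k \<alpha>)" unfolding m_def using not_less_Least by (metis lessI)
  then show ?thesis using that[of k] k m by (simp add: not_less)
qed

text \<open>Operations of the other kind weigh nothing, so several prefixes may have weight
  \<open>x\<close>; the one wanted is followed by an operation of the right kind.\<close>

lemma locate_start:
  assumes "x \<in> boundaries f \<alpha>" "x < weight f \<alpha>"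
  obtains k where "k < length \<alpha>" "weight f (take k \<alpha>) = x" "0 < f (\<alpha> ! k)"
proof -
  obtain k where k: "k < length \<alpha>" "weight f (take k \<alpha>) \<le> x" "x < weight f (take (Suc k) \<alpha>)"
    using assms(2) by (rule locate_op)
  have "0 < f (\<alpha> ! k)" using k by (simp add: weight_take_Suc)
  then have "is_block (boundaries f \<alpha>) (weight f (take k \<alpha>)) (weight f (take (Suc k) \<alpha>))"
    using is_block_op k by blast
  then have "weight f (take k \<alpha>) = x" using k assms(1) unfolding is_block_def by (metis le_neq_implies_less)
  then show ?thesis using that k \<open>0 < f (\<alpha> ! k)\<close> by blast
qed

lemma locate_end:
  assumes "Suc x \<in> boundaries f \<alpha>" "x < weight f \<alpha>"
  obtains k where "k < length \<alpha>" "weight f (take (Suc k) \<alpha>) = Suc x" "0 < f (\<alpha> ! k)"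
proof -
  obtain k where k: "k < length \<alpha>" "weight f (take k \<alpha>) \<le> x" "x < weight f (take (Suc k) \<alpha>)"
    using assms(2) by (rule locate_op)
  have "0 < f (\<alpha> ! k)" using k by (simp add: weight_take_Suc)
  then have "is_block (boundaries f \<alpha>) (weight f (take k \<alpha>)) (weight f (take (Suc k) \<alpha>))"
    using is_block_op k by blast
  then have "weight f (take (Suc k) \<alpha>) = Suc x"
    using k assms(1) unfolding is_block_def by (metis le_imp_less_Suc Suc_lessI)
  then show ?thesis using that k \<open>0 < f (\<alpha> ! k)\<close> by blast
qed

lemma prefix_weight_in_boundaries: "weight f X \<in> boundaries f (X @ S)"
  using weight_take_in_boundaries[of f "length X" "X @ S"] by simp

lemma boundaries_append_cong:
  assumes "boundaries f S = boundaries f S'"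
  shows "boundaries f (X @ S) = boundaries f (X @ S')"
proof (rule set_eqI)
  fix x
  show "x \<in> boundaries f (X @ S) \<longleftrightarrow> x \<in> boundaries f (X @ S')"
  proof (cases "x \<le> weight f X")
    case True then show ?thesis using boundaries_append_le by blast
  next
    case False
    then obtain y where "x = weight f X + y" by (metis le_add_diff_inverse nat_le_linear)
    then show ?thesis using assms boundaries_append_add by metis
  qed
qed

lemma boundaries_weightless: "weight f F = 0 \<Longrightarrow> boundaries f (F @ Z) = boundaries f Z"
  using boundaries_append_add[of f F _ Z] by (metis add_0 set_eqI)

lemma boundaries_replicate:
  assumes "f x = 1" "y \<le> m"
  shows "y \<in> boundaries f (replicate m x @ S)"
proof -
  have "y = weight f (take y (replicate m x @ S))" using assms by (simp add: sum_list_replicate)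
  then show ?thesis using weight_take_in_boundaries by metis
qed

text \<open>The run of the sequence in which every block is pushed and popped one element at a time, with the
  output listed in the order of the pops. It only depends on the underlying Dyck path, and the actual run
  differs from it by the reversal of the blocks.\<close>

fun unit_step :: "op \<Rightarrow> nat \<times> nat list \<times> nat list \<Rightarrow> nat \<times> nat list \<times> nat list" where
  "unit_step (Push a) (m, w, out) = (m + a, rev [m..<m + a] @ w, out)"
| "unit_step (Pop b) (m, w, out) = (m, drop b w, out @ take b w)"

definition unit_run :: "op list \<Rightarrow> nat \<times> nat list \<times> nat list" where
  "unit_run \<alpha> = fold unit_step \<alpha> (0, [], [])"

definition unit_stack :: "op list \<Rightarrow> nat list" where
  "unit_stack \<alpha> = fst (snd (unit_run \<alpha>))"

definition unit_out :: "op list \<Rightarrow> nat list" where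
  "unit_out \<alpha> = snd (snd (unit_run \<alpha>))"

lemma unit_run_eq: "unit_run \<alpha> = (weight push_size \<alpha>, unit_stack \<alpha>, unit_out \<alpha>)"
proof -
  have "fst (fold unit_step \<alpha> s) = fst s + weight push_size \<alpha>" for s
  proof (induction \<alpha> arbitrary: s)
    case (Cons x \<alpha>)
    obtain m w out where s: "s = (m, w, out)" by (cases s) auto
    show ?case by (cases x) (auto simp: Cons s)
  qed simp
  then have "fst (unit_run \<alpha>) = weight push_size \<alpha>" by (simp add: unit_run_def)
  then show ?thesis by (simp add: unit_stack_def unit_out_def prod_eq_iff)
qed

lemma unit_run_snoc: "unit_run (\<alpha> @ [x]) = unit_step x (unit_run \<alpha>)"
  by (simp add: unit_run_def)

lemma unit_snoc [simp]:
  "unit_stack (\<alpha> @ [Push a]) = rev [weight push_size \<alpha>..<weight push_size \<alpha> + a] @ unit_stack \<alpha>"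
  "unit_out (\<alpha> @ [Push a]) = unit_out \<alpha>"
  "unit_stack (\<alpha> @ [Pop b]) = drop b (unit_stack \<alpha>)"
  "unit_out (\<alpha> @ [Pop b]) = unit_out \<alpha> @ take b (unit_stack \<alpha>)"
  using unit_run_snoc[of \<alpha> "Push a"] unit_run_snoc[of \<alpha> "Pop b"]
  unfolding unit_run_eq by auto

lemma unit_Nil [simp]: "unit_stack [] = []" "unit_out [] = []"
  by (simp_all add: unit_stack_def unit_out_def unit_run_def)

lemma push_state:
  assumes "distinct (out @ w)" "set (out @ w) = {..<m}" "sorted_wrt (>) w"
  shows "distinct (out @ rev [m..<m + a] @ w) \<and> set (out @ rev [m..<m + a] @ w) = {..<m + a} \<and>
    sorted_wrt (>) (rev [m..<m + a] @ w)"
proof -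
  have lt: "x < m" if "x \<in> set out \<or> x \<in> set w" for x using assms(2) that by auto
  have "set (out @ rev [m..<m + a] @ w) = set (out @ w) \<union> {m..<m + a}" by auto
  also have "\<dots> = {..<m + a}" unfolding assms(2) by auto
  finally have "set (out @ rev [m..<m + a] @ w) = {..<m + a}" .
  moreover have "distinct (out @ rev [m..<m + a] @ w)" using assms(1) lt by fastforce
  moreover have "sorted_wrt (>) (rev [m..<m + a] @ w)"
    using assms(3) lt by (force simp: sorted_wrt_append sorted_wrt_rev)
  ultimately show ?thesis by blast
qed

lemma pop_state:
  assumes "distinct (out @ w)" "set (out @ w) = {..<m}" "sorted_wrt (>) w"
  shows "distinct ((out @ take b w) @ drop b w) \<and> set ((out @ take b w) @ drop b w) = {..<m} \<and>
    sorted_wrt (>) (drop b w)"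
proof -
  have "(out @ take b w) @ drop b w = out @ w" by simp
  moreover have "sorted_wrt (>) (drop b w)" using assms(3) by (metis append_take_drop_id sorted_wrt_append)
  ultimately show ?thesis using assms by simp
qed

section \<open>The matching of push and pop steps of a single sequence\<close>

locale wf_seq =
  fixes \<alpha> :: "op list"
  assumes wf: "well_formed \<alpha>"
begin

abbreviation "n \<equiv> weight push_size \<alpha>"
abbreviation "PB k \<equiv> weight push_size (take k \<alpha>)"
abbreviation "QB k \<equiv> weight pop_size (take k \<alpha>)"
abbreviation "B \<equiv> boundaries push_size \<alpha>"
abbreviation "C \<equiv> boundaries pop_size \<alpha>"
abbreviation "W k \<equiv> unit_stack (take k \<alpha>)"

lemma weight_pop: "weight pop_size \<alpha> = n"
  using wf by (simp add: well_formed_def)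

lemma QB_le_PB: "k \<le> length \<alpha> \<Longrightarrow> QB k \<le> PB k"
  using wf by (simp add: well_formed_def)

lemma arg_pos: "k < length \<alpha> \<Longrightarrow> 0 < op_arg (\<alpha> ! k)"
  using wf nth_mem[of k \<alpha>] by (auto simp: well_formed_def Suc_le_eq)

lemma unit_state:
  "k \<le> length \<alpha> \<Longrightarrow> length (unit_out (take k \<alpha>)) = QB k \<and> length (W k) + QB k = PB k \<and>
     distinct (unit_out (take k \<alpha>) @ W k) \<and> set (unit_out (take k \<alpha>) @ W k) = {..<PB k} \<and>
     sorted_wrt (>) (W k)"
proof (induction k)
  case (Suc k)
  note IH = Suc.IH[OF Suc_leD[OF Suc.prems]]
  have k: "take (Suc k) \<alpha> = take k \<alpha> @ [\<alpha> ! k]" using Suc.prems by (simp add: take_Suc_conv_app_nth)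
  show ?case
  proof (cases "\<alpha> ! k")
    case (Push a)
    show ?thesis using IH push_state[of "unit_out (take k \<alpha>)" "W k" "PB k" a] unfolding k Push by simp
  next
    case (Pop b)
    have b: "b \<le> length (W k)" using QB_le_PB[OF Suc.prems] IH unfolding k Pop by auto
    show ?thesis using IH b pop_state[of "unit_out (take k \<alpha>)" "W k" "PB k" b] unfolding k Pop by simp
  qed
qed simp

lemma unit_out_take:
  assumes "i \<le> k" "k \<le> length \<alpha>"
  shows "unit_out (take i \<alpha>) = take (QB i) (unit_out (take k \<alpha>))"
  using assms
proof (induction k rule: dec_induct)
  case base
  then show ?case using unit_state[of i] by simp
next
  case (step k)
  have k: "take (Suc k) \<alpha> = take k \<alpha> @ [\<alpha> ! k]" using step.prems by (simp add: take_Suc_conv_app_nth)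
  have "QB i \<le> length (unit_out (take k \<alpha>))"
    using unit_state[of k] step weight_take_mono[OF step.hyps(1)] by auto
  then show ?case using step unfolding k by (cases "\<alpha> ! k") auto
qed

text \<open>The \<open>j\<close>-th pop step of the Dyck path is matched with the push step \<open>N j\<close>; \<open>M\<close> is the inverse matching.
  All steps are counted from 0, whereas the elements on the stacks are counted from 1.\<close>

definition N :: "nat \<Rightarrow> nat" where
  "N j = (if j < n then unit_out \<alpha> ! j else j)"

definition M :: "nat \<Rightarrow> nat" where "M = inv N"

lemma unit_out_final: "length (unit_out \<alpha>) = n" "distinct (unit_out \<alpha>)" "set (unit_out \<alpha>) = {..<n}"
  using unit_state[of "length \<alpha>"] weight_pop by auto

lemma N_less [simp]: "N j < n \<longleftrightarrow> j < n"
  using unit_out_final nth_mem[of j "unit_out \<alpha>"] by (auto simp: N_def)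

text \<open>Below \<open>n\<close> this is the output of the unit run, which lists
  \<open>{..<n}\<close> without repetition; the identity from \<open>n\<close> on completes it to a
  permutation of all natural numbers.\<close>

lemma bij_N: "bij N"
proof (rule bijI)
  show "inj N"
  proof (rule injI)
    fix x y assume e: "N x = N y"
    then have "x < n \<longleftrightarrow> y < n" using N_less by metis
    then show "x = y" using e unit_out_final nth_eq_iff_index_eq[OF unit_out_final(2), of x y]
      by (auto simp: N_def split: if_splits)
  qed
  show "surj N"
  proof (rule surjI)
    fix x
    show "N (if x < n then (SOME j. j < n \<and> unit_out \<alpha> ! j = x) else x) = x"
    proof (cases "x < n")
      case True
      then have "\<exists>j. j < n \<and> unit_out \<alpha> ! j = x" using unit_out_final by (metis in_set_conv_nth lessThan_iff)
      then show ?thesis using True someI_ex[of "\<lambda>j. j < n \<and> unit_out \<alpha> ! j = x"] by (auto simp: N_def)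
    qed (simp add: N_def)
  qed
qed

lemma MN [simp]: "M (N j) = j"
  using bij_N by (simp add: M_def bij_is_inj)

lemma NM [simp]: "N (M i) = i"
  using bij_N by (simp add: M_def bij_is_surj surj_f_inv_f)

lemma M_less [simp]: "M i < n \<longleftrightarrow> i < n"
  using N_less[of "M i"] by simp

lemma N_nth: "k \<le> length \<alpha> \<Longrightarrow> j < QB k \<Longrightarrow> N j = unit_out (take k \<alpha>) ! j"
  using unit_out_take[of k "length \<alpha>"] weight_take_le[of pop_size k \<alpha>] weight_pop by (simp add: N_def)

lemma N_less_PB: "k \<le> length \<alpha> \<Longrightarrow> j < QB k \<Longrightarrow> N j < PB k"
proof -
  assume k: "k \<le> length \<alpha>" "j < QB k"
  then have "N j \<in> set (unit_out (take k \<alpha>))" using N_nth unit_state by auto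
  then show ?thesis using unit_state[OF k(1)] by auto
qed

lemma M_ge_QB: "k \<le> length \<alpha> \<Longrightarrow> PB k \<le> x \<Longrightarrow> QB k \<le> M x"
  using N_less_PB[of k "M x"] by (metis NM leD leI)

lemma in_stack_iff:
  assumes k: "k \<le> length \<alpha>"
  shows "x \<in> set (W k) \<longleftrightarrow> x < PB k \<and> QB k \<le> M x"
proof -
  have "x \<in> set (unit_out (take k \<alpha>)) \<longleftrightarrow> M x < QB k"
  proof
    assume "x \<in> set (unit_out (take k \<alpha>))"
    then obtain j where "j < QB k" "unit_out (take k \<alpha>) ! j = x" using unit_state[OF k] by (metis in_set_conv_nth)
    then show "M x < QB k" using N_nth[OF k] by (metis MN)
  next
    assume "M x < QB k"
    then show "x \<in> set (unit_out (take k \<alpha>))" using N_nth[OF k] unit_state[OF k] by (metis NM nth_mem)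
  qed
  moreover have "set (unit_out (take k \<alpha>)) \<union> set (W k) = {..<PB k}"
    "set (unit_out (take k \<alpha>)) \<inter> set (W k) = {}"
    using unit_state[OF k] by (simp_all only: set_append distinct_append)
  ultimately show ?thesis by (metis IntI UnCI UnE empty_iff leD leI lessThan_iff)
qed

lemma N_pop:
  assumes k: "k < length \<alpha>" "\<alpha> ! k = Pop b" and u: "u < b"
  shows "N (QB k + u) = W k ! u" "u < length (W k)"
proof -
  have s: "take (Suc k) \<alpha> = take k \<alpha> @ [Pop b]" using k by (simp add: take_Suc_conv_app_nth)
  have b: "b \<le> length (W k)" using QB_le_PB[of "Suc k"] k unit_state[of k] unfolding s by auto
  then show "u < length (W k)" using u by simp
  have "N (QB k + u) = unit_out (take (Suc k) \<alpha>) ! (QB k + u)"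
    using N_nth[of "Suc k" "QB k + u"] k u unfolding s by auto
  then show "N (QB k + u) = W k ! u"
    using unit_state[of k] k u b unfolding s by (simp add: nth_append)
qed

text \<open>If \<open>x\<close> were popped first, then \<open>y\<close> would still be on the stack
  at that operation, above \<open>x\<close>, and would therefore precede it within the same
  pop.\<close>

lemma stack_order:
  assumes k: "k \<le> length \<alpha>" and xy: "x \<in> set (W k)" "y \<in> set (W k)" "x < y"
  shows "M y < M x"
proof (rule ccontr)
  assume "\<not> M y < M x"
  moreover have "M x \<noteq> M y" using xy by (metis NM nat_neq_iff)
  ultimately have lt: "M x < M y" by simp
  have x: "x < PB k" "QB k \<le> M x" and y: "y < PB k" "QB k \<le> M y" using in_stack_iff[OF k] xy by auto
  have "M x < weight pop_size \<alpha>" using x weight_take_le[of push_size k \<alpha>] weight_pop by simp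
  then obtain q where q: "q < length \<alpha>" "QB q \<le> M x" "M x < QB (Suc q)" by (rule locate_op)
  have kq: "k \<le> q" using q x weight_take_mono[of "Suc q" k pop_size \<alpha>] by (meson leD less_le_trans not_less_eq_eq)
  obtain b where b: "\<alpha> ! q = Pop b" using q by (cases "\<alpha> ! q") (auto simp: weight_take_Suc)
  have in_q: "x \<in> set (W q)" "y \<in> set (W q)"
    using in_stack_iff[of q] q x y lt weight_take_mono[OF kq, of push_size \<alpha>] by auto
  have u: "M x - QB q < b" using q b by (auto simp: weight_take_Suc)
  have xu: "x = W q ! (M x - QB q)" using N_pop(1)[OF q(1) b u] q(2) by simp
  obtain v where v: "v < length (W q)" "y = W q ! v" using in_q(2) by (metis in_set_conv_nth)
  have "sorted_wrt (>) (W q)" using unit_state[of q] q by simp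
  then have "v < M x - QB q"
    using xu v xy(3) N_pop(2)[OF q(1) b u] sorted_wrt_nth_less by (metis nat_neq_iff less_asym)
  then have "N (QB q + v) = y" using N_pop(1)[OF q(1) b, of v] u v by simp
  then have "M y = QB q + v" using MN by metis
  then show False using lt \<open>v < M x - QB q\<close> by simp
qed

lemma push_between:
  assumes k: "k < length \<alpha>" and x: "PB k \<le> x" "x < PB (Suc k)"
  shows "x \<in> set (W (Suc k))"
proof -
  obtain a where "\<alpha> ! k = Push a" using k x by (cases "\<alpha> ! k") (auto simp: weight_take_Suc)
  then have "QB (Suc k) = QB k" using k by (simp add: weight_take_Suc)
  then show ?thesis using in_stack_iff[of "Suc k" x] M_ge_QB[of k x] k x by auto
qed

lemma M_decreasing_in_push:
  assumes "k < length \<alpha>" "PB k \<le> x" "Suc x < PB (Suc k)"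
  shows "M (Suc x) < M x"
  using assms push_between[of k x] push_between[of k "Suc x"] stack_order[of "Suc k" x "Suc x"] by auto

lemma N_decreasing_in_pop:
  assumes k: "k < length \<alpha>" and j: "QB k \<le> j" "Suc j < QB (Suc k)"
  shows "N (Suc j) < N j"
proof -
  obtain b where b: "\<alpha> ! k = Pop b" using k j by (cases "\<alpha> ! k") (auto simp: weight_take_Suc)
  obtain u where u: "j = QB k + u" "Suc u < b" using j b k by (auto simp: le_iff_add weight_take_Suc)
  have "W k ! Suc u < W k ! u"
    using unit_state[of k] k N_pop(2)[OF k b, of "Suc u"] u by (auto simp: sorted_wrt_iff_nth_less)
  then show ?thesis using N_pop(1)[OF k b, of u] N_pop(1)[OF k b, of "Suc u"] u by simp
qed

text \<open>When the pop starts, \<open>x\<close> has already left the stack or is on top of it, so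
  it is popped no later than the first step of this pop. The step \<open>Suc x\<close> is pushed
  afterwards and leaves after the whole pop.\<close>

lemma M_increasing_over_pop:
  assumes q: "q < length \<alpha>" "is_pop (\<alpha> ! q)" "PB q = Suc x"
  shows "M x < M (Suc x)"
proof -
  obtain b where b: "\<alpha> ! q = Pop b" "0 < b" using q arg_pos[of q] by (cases "\<alpha> ! q") auto
  let ?y = "N (QB q)"
  have "?y \<in> set (W q)" using N_pop[OF q(1) b] nth_mem by fastforce
  then have y: "?y \<le> x" using in_stack_iff[of q] q by auto
  have "M x \<le> QB q"
  proof (rule ccontr)
    assume "\<not> M x \<le> QB q"
    then have c: "QB q < M x" by simp
    then have "x \<in> set (W q)" using in_stack_iff[of q] q by auto
    moreover have "?y \<noteq> x" using c MN by (metis nat_neq_iff)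
    ultimately have "M x < M ?y" using stack_order[of q ?y x] \<open>?y \<in> set (W q)\<close> y q by auto
    then show False using c by simp
  qed
  moreover have "QB (Suc q) \<le> M (Suc x)" using M_ge_QB[of "Suc q" "Suc x"] q b by (simp add: weight_take_Suc)
  moreover have "QB q < QB (Suc q)" using q b by (simp add: weight_take_Suc)
  ultimately show ?thesis by simp
qed

text \<open>If \<open>Suc j\<close> popped something older than the push, the newly pushed step,
  lying above it, would have to leave earlier; but nothing is popped between \<open>j\<close> and
  \<open>Suc j\<close>.\<close>

lemma N_increasing_over_push:
  assumes q: "q < length \<alpha>" "is_push (\<alpha> ! q)" "QB q = Suc j"
  shows "N j < N (Suc j)"
proof (rule ccontr)
  obtain a where a: "\<alpha> ! q = Push a" "0 < a" using q arg_pos[of q] by (cases "\<alpha> ! q") auto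
  assume "\<not> N j < N (Suc j)"
  moreover have nj: "N j < PB q" using N_less_PB[of q j] q by simp
  ultimately have y: "N (Suc j) < PB q" by simp
  let ?x = "PB q"
  have "?x \<in> set (W (Suc q))" using push_between[of q ?x] q a by (simp add: weight_take_Suc)
  moreover have "N (Suc j) \<in> set (W (Suc q))"
    using in_stack_iff[of "Suc q"] q a y by (simp add: weight_take_Suc)
  ultimately have "M ?x < M (N (Suc j))" using stack_order[of "Suc q" "N (Suc j)" ?x] y q by simp
  moreover have "Suc j \<le> M ?x" using M_ge_QB[of q ?x] q by simp
  ultimately show False by simp
qed

lemma blocking_push: "blocking n M B"
  unfolding blocking_def
proof (intro conjI allI impI)
  show "boundary_set n B" by (rule boundary_set_boundaries)
  fix x assume x: "Suc x \<notin> B"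
  then have "x < n" by (auto simp: boundaries_def)
  then obtain k where k: "k < length \<alpha>" "PB k \<le> x" "x < PB (Suc k)" by (rule locate_op)
  have "PB (Suc k) \<noteq> Suc x" using x weight_take_in_boundaries by metis
  then show "M (Suc x) < M x" using M_decreasing_in_push[of k x] k by simp
qed

lemma blocking_pop: "blocking n N C"
  unfolding blocking_def
proof (intro conjI allI impI)
  show "boundary_set n C" using boundary_set_boundaries[of pop_size \<alpha>] weight_pop by simp
  fix x assume x: "Suc x \<notin> C"
  then have "x < weight pop_size \<alpha>" by (auto simp: boundaries_def)
  then obtain k where k: "k < length \<alpha>" "QB k \<le> x" "x < QB (Suc k)" by (rule locate_op)
  have "QB (Suc k) \<noteq> Suc x" using x weight_take_in_boundaries by metis
  then show "N (Suc x) < N x" using N_decreasing_in_pop[of k x] k by simp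
qed

lemma bounds: "boundary_set n B" "boundary_set n C"
  using blocking_push blocking_pop by (auto simp: blocking_def)

section \<open>The actual run as a matching between two reversals\<close>

definition out_at :: "nat \<Rightarrow> nat" where
  "out_at j = block_rev B (N (block_rev C j))"

text \<open>Slot \<open>j\<close> is counted from the bottom of the output stack, that is in the
  order of the pops; hence the \<open>rev\<close> in the last component.\<close>

lemma run_take:
  "k \<le> length \<alpha> \<Longrightarrow> run (take k \<alpha>) (init_state \<alpha>) =
     (map Suc [PB k..<n], map (\<lambda>x. Suc (block_rev B x)) (W k), rev (map (\<lambda>j. Suc (out_at j)) [0..<QB k]))"
proof (induction k)
  case 0
  have "[Suc 0..<Suc n] = map Suc [0..<n]" by (simp add: map_Suc_upt)
  then show ?case by (simp add: run_def init_state_def op_size_def)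
next
  case (Suc k)
  have k: "k < length \<alpha>" using Suc.prems by simp
  have s: "take (Suc k) \<alpha> = take k \<alpha> @ [\<alpha> ! k]" using Suc.prems by (simp add: take_Suc_conv_app_nth)
  have r: "run (take (Suc k) \<alpha>) (init_state \<alpha>) = opstep (\<alpha> ! k) (run (take k \<alpha>) (init_state \<alpha>))"
    unfolding s run_def by simp
  show ?case
  proof (cases "\<alpha> ! k")
    case (Push a)
    have a: "0 < a" "PB (Suc k) = PB k + a" using arg_pos[OF k] Push k by (auto simp: weight_take_Suc)
    have le: "PB k + a \<le> n" using weight_take_le[of push_size "Suc k" \<alpha>] a by simp
    have bl: "is_block B (PB k) (PB k + a)" using is_block_op[OF k, of push_size] Push a by simp
    \<comment> \<open>A block pushed as a whole keeps its order, whereas unit steps would put its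
      last element on top; the reversal makes up for this.\<close>
    have "map (\<lambda>x. Suc (block_rev B x)) (rev [PB k..<PB k + a]) = map Suc [PB k..<PB k + a]"
      by (rule nth_equalityI) (auto simp: rev_nth block_rev_block[OF bl])
    moreover have "take a (map Suc [PB k..<n]) = map Suc [PB k..<PB k + a]"
      "drop a (map Suc [PB k..<n]) = map Suc [PB k + a..<n]"
      using le by (auto simp: take_map drop_map)
    ultimately show ?thesis using Suc unfolding r by (simp add: Push s)
  next
    case (Pop b)
    have b: "0 < b" "QB (Suc k) = QB k + b" using arg_pos[OF k] Pop k by (auto simp: weight_take_Suc)
    have bl: "is_block C (QB k) (QB k + b)" using is_block_op[OF k, of pop_size] Pop b by simp
    have bW: "b \<le> length (W k)" using N_pop(2)[OF k Pop, of "b - 1"] b by linarith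
    \<comment> \<open>A block popped as a whole keeps its order too, so its lowest element takes the
      lowest slot, although it is the last one popped in unit steps.\<close>
    have "take b (map (\<lambda>x. Suc (block_rev B x)) (W k)) = rev (map (\<lambda>j. Suc (out_at j)) [QB k..<QB k + b])"
    proof (rule nth_equalityI)
      fix u assume "u < length (take b (map (\<lambda>x. Suc (block_rev B x)) (W k)))"
      then have u: "u < b" by simp
      have "block_rev C (QB k + (b - Suc u)) = QB k + u" using block_rev_block[OF bl] u by auto
      then show "take b (map (\<lambda>x. Suc (block_rev B x)) (W k)) ! u = rev (map (\<lambda>j. Suc (out_at j)) [QB k..<QB k + b]) ! u"
        using u bW N_pop(1)[OF k Pop u] by (simp add: rev_nth out_at_def)
    qed (use bW in simp)
    moreover have "[0..<QB k + b] = [0..<QB k] @ [QB k..<QB k + b]" by (metis le_add1 upt_add_eq_append zero_le)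
    ultimately show ?thesis using Suc unfolding r by (simp add: Pop s drop_map)
  qed
qed

lemma perm_of_eq: "perm_of \<alpha> = rev (map (\<lambda>j. Suc (out_at j)) [0..<n])"
  using run_take[of "length \<alpha>"] weight_pop by (simp add: perm_of_def)

lemma length_perm_of: "length (perm_of \<alpha>) = n"
  by (simp add: perm_of_eq)

lemma out_at_ge: "n \<le> j \<Longrightarrow> out_at j = j"
proof -
  assume "n \<le> j"
  then have "is_block C j (Suc j)" "is_block B j (Suc j)"
    using bounds unfolding is_block_def boundary_set_def by auto
  then have "block_rev C j = j" "block_rev B j = j" by (auto simp: block_rev_block)
  then show ?thesis using \<open>n \<le> j\<close> by (simp add: out_at_def N_def)
qed

lemma support_push:
  assumes "k < length \<alpha>" "is_push (\<alpha> ! k)"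
  shows "support \<alpha> k = Suc ` {PB k..<PB (Suc k)}"
proof -
  obtain a where a: "\<alpha> ! k = Push a" using assms by (cases "\<alpha> ! k") auto
  have "PB (Suc k) = PB k + a" using a assms by (simp add: weight_take_Suc)
  moreover have "PB (Suc k) \<le> n" by (rule weight_take_le)
  ultimately show ?thesis using run_take[of k] assms a by (simp add: support_def take_map)
qed

lemma support_pop:
  assumes k: "k < length \<alpha>" "is_pop (\<alpha> ! k)"
  shows "support \<alpha> k = Suc ` block_rev B ` N ` {QB k..<QB (Suc k)}"
proof -
  obtain b where b: "\<alpha> ! k = Pop b" using k by (cases "\<alpha> ! k") auto
  have q: "QB (Suc k) = QB k + b" using b k by (simp add: weight_take_Suc)
  have "set (take b (W k)) = N ` {QB k..<QB k + b}"
  proof -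
    have bW: "b \<le> length (W k)" using N_pop(2)[OF k(1) b, of "b - 1"] by (cases b) auto
    have "take b (W k) = map N [QB k..<QB k + b]"
      by (rule nth_equalityI) (use bW N_pop(1)[OF k(1) b] in auto)
    then show ?thesis by simp
  qed
  then show ?thesis using run_take[of k] k b q by (simp add: support_def take_map image_comp)
qed

text \<open>A reversal permutes every block within itself, so two supports meet exactly if the
  matching of the path joins a step of one operation to a step of the other.\<close>

lemma corresponds_iff:
  "corresponds \<alpha> p q \<longleftrightarrow> p < length \<alpha> \<and> q < length \<alpha> \<and>
     (\<exists>x. PB p \<le> x \<and> x < PB (Suc p) \<and> QB q \<le> M x \<and> M x < QB (Suc q))"
proof
  assume c: "corresponds \<alpha> p q"
  then have c': "p < length \<alpha>" "q < length \<alpha>" "is_push (\<alpha> ! p)" "is_pop (\<alpha> ! q)"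
    and "support \<alpha> p \<inter> support \<alpha> q \<noteq> {}" by (auto simp: corresponds_def)
  then obtain j where j: "QB q \<le> j" "j < QB (Suc q)"
    and bj: "PB p \<le> block_rev B (N j)" "block_rev B (N j) < PB (Suc p)"
    by (auto simp: support_push support_pop)
  then have "PB p \<le> N j" "N j < PB (Suc p)"
    using block_rev_less_iff[OF bounds(1) weight_take_in_boundaries] by (meson not_le)+
  then show "p < length \<alpha> \<and> q < length \<alpha> \<and>
     (\<exists>x. PB p \<le> x \<and> x < PB (Suc p) \<and> QB q \<le> M x \<and> M x < QB (Suc q))"
    using c' j by (metis MN)
next
  assume "p < length \<alpha> \<and> q < length \<alpha> \<and>
     (\<exists>x. PB p \<le> x \<and> x < PB (Suc p) \<and> QB q \<le> M x \<and> M x < QB (Suc q))"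
  then obtain x where pq: "p < length \<alpha>" "q < length \<alpha>"
    and x: "PB p \<le> x" "x < PB (Suc p)" and Mx: "QB q \<le> M x" "M x < QB (Suc q)" by auto
  have ops: "is_push (\<alpha> ! p)" "is_pop (\<alpha> ! q)"
    using pq x Mx by (cases "\<alpha> ! p"; cases "\<alpha> ! q"; auto simp: weight_take_Suc)+
  have "PB p \<le> block_rev B x" "block_rev B x < PB (Suc p)"
    using x block_rev_less_iff[OF bounds(1) weight_take_in_boundaries] by (meson not_le)+
  then have "Suc (block_rev B x) \<in> support \<alpha> p" using support_push[OF pq(1) ops(1)] by auto
  moreover have "x \<in> N ` {QB q..<QB (Suc q)}" using Mx by (intro image_eqI[of x N "M x"]) auto
  then have "Suc (block_rev B x) \<in> support \<alpha> q" using support_pop[OF pq(2) ops(2)] by auto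
  ultimately show "corresponds \<alpha> p q" using pq ops by (auto simp: corresponds_def)
qed

end

section \<open>Dyck paths as words of unit operations\<close>

fun unit_ops :: "op \<Rightarrow> op list" where
  "unit_ops (Push a) = replicate a (Push 1)"
| "unit_ops (Pop b) = replicate b (Pop 1)"

definition expand :: "op list \<Rightarrow> op list" where
  "expand \<alpha> = concat (map unit_ops \<alpha>)"

lemma expand_simps [simp]:
  "expand [] = []" "expand (x # \<alpha>) = unit_ops x @ expand \<alpha>" "expand (\<alpha> @ \<beta>) = expand \<alpha> @ expand \<beta>"
  by (simp_all add: expand_def)

lemma weight_expand [simp]:
  "weight push_size (expand \<alpha>) = weight push_size \<alpha>" "weight pop_size (expand \<alpha>) = weight pop_size \<alpha>"
proof (induction \<alpha>)
  case (Cons x \<alpha>)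
  { case 1 show ?case using Cons by (cases x) (auto simp: sum_list_replicate) }
  { case 2 show ?case using Cons by (cases x) (auto simp: sum_list_replicate) }
qed simp_all

lemma fold_unit_step_replicate:
  "fold unit_step (replicate a (Push 1)) (m, w, out) = unit_step (Push a) (m, w, out)"
  "fold unit_step (replicate b (Pop 1)) (m, w, out) = unit_step (Pop b) (m, w, out)"
proof -
  show "fold unit_step (replicate a (Push 1)) (m, w, out) = unit_step (Push a) (m, w, out)"
    by (induction a arbitrary: m w) (auto simp: upt_conv_Cons)
  show "fold unit_step (replicate b (Pop 1)) (m, w, out) = unit_step (Pop b) (m, w, out)"
  proof (induction b arbitrary: w out)
    case (Suc b)
    then show ?case by (cases w) auto
  qed simp
qed

lemma unit_run_expand: "unit_run (expand \<alpha>) = unit_run \<alpha>"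
proof -
  have "fold unit_step (expand \<alpha>) s = fold unit_step \<alpha> s" for s
  proof (induction \<alpha> arbitrary: s)
    case (Cons x \<alpha>)
    then show ?case by (cases x; cases s) (simp_all only: expand_simps unit_ops.simps fold_append o_apply
        fold_simps fold_unit_step_replicate)
  qed simp
  then show ?thesis by (simp add: unit_run_def)
qed

lemma expand_pushes: "\<forall>x\<in>set R. is_push x \<Longrightarrow> expand R = replicate (weight push_size R) (Push 1)"
proof (induction R)
  case (Cons x R)
  then show ?case by (cases x) (auto simp: replicate_add)
qed simp

lemma expand_pops: "\<forall>x\<in>set F. is_pop x \<Longrightarrow> expand F = replicate (weight pop_size F) (Pop 1)"
proof (induction F)
  case (Cons x F)
  then show ?case by (cases x) (auto simp: replicate_add)
qed simp

lemma weight_zero: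
  "\<forall>x\<in>set R. is_push x \<Longrightarrow> weight pop_size R = 0"
  "\<forall>x\<in>set F. is_pop x \<Longrightarrow> weight push_size F = 0"
  by (auto simp: sum_list_eq_0_iff, (metis is_push.simps(2) pop_size.elims pop_size.simps)) (metis is_pop.simps(1) push_size.elims)

text \<open>The prefix condition of well-formedness in recursive form, with a starting height, so
  that its invariance under expansion is a plain induction.\<close>

fun stays_nonneg :: "nat \<Rightarrow> op list \<Rightarrow> bool" where
  "stays_nonneg h [] = True"
| "stays_nonneg h (Push a # xs) = stays_nonneg (h + a) xs"
| "stays_nonneg h (Pop b # xs) = (b \<le> h \<and> stays_nonneg (h - b) xs)"

lemma stays_nonneg_iff:
  "stays_nonneg h \<alpha> \<longleftrightarrow> (\<forall>k\<le>length \<alpha>. weight pop_size (take k \<alpha>) \<le> h + weight push_size (take k \<alpha>))"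
proof (induction \<alpha> arbitrary: h)
  case (Cons x \<alpha>)
  have split: "(\<forall>k\<le>length (x # \<alpha>). P k) \<longleftrightarrow> P 0 \<and> (\<forall>k\<le>length \<alpha>. P (Suc k))" for P
    by (metis Suc_le_mono length_Cons not0_implies_Suc zero_le)
  show ?case
  proof (cases x)
    case (Push a)
    then show ?thesis unfolding split by (simp add: Cons add.assoc)
  next
    case (Pop b)
    have "b \<le> h" if "\<forall>k\<le>length \<alpha>. b + weight pop_size (take k \<alpha>) \<le> h + weight push_size (take k \<alpha>)"
      using that[rule_format, of 0] by simp
    moreover have "weight pop_size (take k \<alpha>) \<le> h - b + weight push_size (take k \<alpha>) \<longleftrightarrow>
        b + weight pop_size (take k \<alpha>) \<le> h + weight push_size (take k \<alpha>)" if "b \<le> h" for k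
      using that by linarith
    ultimately show ?thesis unfolding split using Pop Cons by auto
  qed
qed simp

lemma stays_nonneg_replicate:
  "stays_nonneg h (replicate a (Push 1) @ xs) = stays_nonneg (h + a) xs"
  "stays_nonneg h (replicate b (Pop 1) @ xs) = (b \<le> h \<and> stays_nonneg (h - b) xs)"
proof -
  show "stays_nonneg h (replicate a (Push 1) @ xs) = stays_nonneg (h + a) xs"
    by (induction a arbitrary: h) auto
  show "stays_nonneg h (replicate b (Pop 1) @ xs) = (b \<le> h \<and> stays_nonneg (h - b) xs)"
  proof (induction b arbitrary: h)
    case (Suc b)
    then show ?case by (cases h) auto
  qed simp
qed

lemma stays_nonneg_expand: "stays_nonneg h (expand \<alpha>) = stays_nonneg h \<alpha>"
proof (induction \<alpha> arbitrary: h)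
  case (Cons x \<alpha>)
  then show ?case by (cases x) (simp_all add: stays_nonneg_replicate[unfolded One_nat_def])
qed simp

lemma well_formed_expand_cong:
  assumes "well_formed \<alpha>" "expand \<beta> = expand \<alpha>" "\<forall>x\<in>set \<beta>. 1 \<le> op_arg x"
  shows "well_formed \<beta>"
proof -
  have "weight push_size \<beta> = weight push_size \<alpha>" "weight pop_size \<beta> = weight pop_size \<alpha>"
    using assms(2) weight_expand by metis+
  moreover have "stays_nonneg 0 \<beta> = stays_nonneg 0 \<alpha>" using assms(2) stays_nonneg_expand by metis
  ultimately show ?thesis using assms unfolding well_formed_def stays_nonneg_iff by simp
qed

text \<open>For each pop step the number of pushes before it, starting from \<open>m\<close>.
  Together with the total number of pushes this list encodes the Dyck path.\<close>

fun pop_heights :: "nat \<Rightarrow> op list \<Rightarrow> nat list" where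
  "pop_heights m [] = []"
| "pop_heights m (Push a # xs) = pop_heights (m + a) xs"
| "pop_heights m (Pop b # xs) = replicate b m @ pop_heights m xs"

lemma length_pop_heights: "length (pop_heights m \<alpha>) = weight pop_size \<alpha>"
  by (induction m \<alpha> rule: pop_heights.induct) auto

lemma pop_heights_ge: "x \<in> set (pop_heights m \<alpha>) \<Longrightarrow> m \<le> x"
  by (induction m \<alpha> rule: pop_heights.induct) fastforce+

lemma pop_heights_expand: "pop_heights m (expand \<alpha>) = pop_heights m \<alpha>"
proof -
  have "pop_heights m (replicate a (Push 1) @ xs) = pop_heights (m + a) xs" for m a xs
    by (induction a arbitrary: m) auto
  moreover have "pop_heights m (replicate b (Pop 1) @ xs) = replicate b m @ pop_heights m xs" for m b xs
    by (induction b) auto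
  ultimately show ?thesis by (induction m \<alpha> rule: pop_heights.induct) simp_all
qed

lemma pop_heights_nth:
  assumes "k < length \<alpha>" "weight pop_size (take k \<alpha>) \<le> j" "j < weight pop_size (take (Suc k) \<alpha>)"
  shows "pop_heights m \<alpha> ! j = m + weight push_size (take k \<alpha>)"
  using assms
proof (induction m \<alpha> arbitrary: k j rule: pop_heights.induct)
  case (2 m a xs)
  then show ?case by (cases k) auto
next
  case (3 m b xs)
  show ?case
  proof (cases k)
    case 0 then show ?thesis using 3 by (simp add: nth_append)
  next
    case (Suc k')
    then show ?thesis using 3(1)[of k' "j - b"] 3(2-4) by (simp add: nth_append)
  qed
qed simp

lemma pop_heights_inject:
  assumes "set u \<subseteq> {Push 1, Pop 1}" "set v \<subseteq> {Push 1, Pop 1}"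
    "pop_heights m u = pop_heights m v" "weight push_size u = weight push_size v"
  shows "u = v"
  using assms
proof (induction u arbitrary: v m)
  case Nil
  then show ?case by (cases v) auto
next
  case (Cons x u)
  \<comment> \<open>Two words with different first letters are told apart by the first entry: it is
    \<open>m\<close> after a pop, but at least \<open>m + 1\<close> after a push.\<close>
  have mixed: False if "pop_heights (m + 1) xs = m # ys" for xs ys
    using pop_heights_ge[of m "m + 1" xs] that by simp
  from Cons.prems(1,2) have x: "x = Push 1 \<or> x = Pop 1" by auto
  show ?case
  proof (cases v)
    case Nil
    then show ?thesis using Cons.prems x by auto
  next
    case (Cons y w)
    then have y: "y = Push 1 \<or> y = Pop 1" using Cons.prems by auto
    from x y show ?thesis
    proof (elim disjE)
      assume "x = Push 1" "y = Push 1"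
      then show ?thesis using Cons.IH[of w "m + 1"] Cons.prems Cons by simp
    next
      assume "x = Pop 1" "y = Pop 1"
      then show ?thesis using Cons.IH[of w m] Cons.prems Cons by simp
    next
      assume "x = Push 1" "y = Pop 1"
      then show ?thesis using mixed Cons.prems(3) Cons by fastforce
    next
      assume "x = Pop 1" "y = Push 1"
      then show ?thesis using mixed[OF sym] Cons.prems(3) Cons by fastforce
    qed
  qed
qed

lemma set_expand: "set (expand \<alpha>) \<subseteq> {Push 1, Pop 1}"
proof (induction \<alpha>)
  case (Cons x \<alpha>)
  then show ?case by (cases x) auto
qed simp

lemma in_set_drop_take:
  assumes "x \<in> set (drop i (take j xs))" "j \<le> length xs"
  shows "\<exists>q. i \<le> q \<and> q < j \<and> x = xs ! q"
proof -
  obtain u where u: "u < length (drop i (take j xs))" "drop i (take j xs) ! u = x"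
    using assms(1) by (meson in_set_conv_nth)
  have "i + u < j" using u(1) assms(2) by simp
  moreover have "x = xs ! (i + u)" using u calculation by simp
  ultimately show ?thesis by (metis le_add1)
qed

section \<open>Reduced sequences and closed intervals\<close>

context wf_seq
begin

lemma unit_ops_nonempty: "x \<in> set \<alpha> \<Longrightarrow> unit_ops x \<noteq> []"
  using wf by (cases x) (auto simp: well_formed_def)

text \<open>In a reduced sequence the last element pushed before a fall is popped at once, so it is the largest
  element output so far.\<close>

lemma reduced_pop_height:
  assumes red: "reduced \<alpha>" and k: "k < length \<alpha>" "QB k \<le> j" "j < QB (Suc k)"
  shows "PB k = Suc (Max (out_at ` {..j}))"
proof -
  obtain b where b: "\<alpha> ! k = Pop b" "0 < b" using k by (cases "\<alpha> ! k") (auto simp: weight_take_Suc)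
  have PBk: "PB (Suc k) = PB k" using k b by (simp add: weight_take_Suc)
  have upper: "out_at i < PB k" if "i \<le> j" for i
  proof -
    have "block_rev C i < QB (Suc k)"
      using block_rev_less_iff[OF bounds(2) weight_take_in_boundaries] that k by simp
    then have "N (block_rev C i) < PB k" using N_less_PB[of "Suc k"] k PBk by simp
    then show ?thesis
      unfolding out_at_def using block_rev_less_iff[OF bounds(1) weight_take_in_boundaries] by blast
  qed
  have pos: "0 < PB k" using upper[of j] by simp
  have "PB k - 1 < n" using pos weight_take_le[of push_size k \<alpha>] by simp
  \<comment> \<open>\<open>r\<close> is the last push before the pop \<open>k\<close>, so the
    operation after it is a pop and reducedness applies to the two.\<close>
  then obtain r where r: "r < length \<alpha>" "PB r \<le> PB k - 1" "PB k - 1 < PB (Suc r)" by (rule locate_op)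
  have rk: "r < k" using r pos weight_take_mono[of k r push_size \<alpha>] by (meson leD leI le_less_trans less_le_trans diff_less zero_less_one)
  have PBr: "PB (Suc r) = PB k" using r weight_take_mono[of "Suc r" k push_size \<alpha>] rk by simp
  have push: "is_push (\<alpha> ! r)" using r by (cases "\<alpha> ! r") (auto simp: weight_take_Suc)
  have sr: "Suc r < length \<alpha>" using rk k by simp
  have pop: "is_pop (\<alpha> ! Suc r)"
  proof (rule ccontr)
    assume "\<not> is_pop (\<alpha> ! Suc r)"
    then obtain a where a: "\<alpha> ! Suc r = Push a" "0 < a" using arg_pos[OF sr] by (cases "\<alpha> ! Suc r") auto
    then have "Suc r \<noteq> k" using b by auto
    then have "PB (Suc (Suc r)) \<le> PB k" using weight_take_mono[of "Suc (Suc r)" k push_size \<alpha>] rk by simp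
    then show False using weight_take_Suc[OF sr, of push_size] a PBr by simp
  qed
  have ops: "\<alpha> ! r = Push 1" "\<alpha> ! Suc r = Pop 1" using red push pop sr unfolding reduced_def by auto
  let ?i = "QB (Suc r)"
  have "is_block C ?i (Suc ?i)" using is_block_op[OF sr, of pop_size] ops weight_take_Suc[OF sr, of pop_size] by simp
  then have c: "block_rev C ?i = ?i" by (auto simp: block_rev_block)
  have "is_block B (PB r) (Suc (PB r))" using is_block_op[OF r(1), of push_size] ops weight_take_Suc[OF r(1), of push_size] by simp
  then have bb: "block_rev B (PB r) = PB r" by (auto simp: block_rev_block)
  have "W (Suc r) = PB r # W r" using r ops by (simp add: take_Suc_conv_app_nth)
  then have "N ?i = PB r" using N_pop(1)[OF sr ops(2), of 0] by simp
  then have "out_at ?i = PB r" by (simp add: out_at_def c bb)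
  moreover have "PB k = Suc (PB r)" using PBr weight_take_Suc[OF r(1), of push_size] ops by simp
  moreover have "?i \<le> j" using weight_take_mono[of "Suc r" k pop_size \<alpha>] rk k by simp
  moreover have "Max (out_at ` {..j}) = PB r"
  proof (rule Max_eqI)
    show "PB r \<in> out_at ` {..j}" using calculation by (metis atMost_iff image_eqI)
    fix y assume "y \<in> out_at ` {..j}"
    then obtain i where "i \<le> j" "y = out_at i" by auto
    then show "y \<le> PB r" using upper[of i] calculation by simp
  qed simp
  ultimately show ?thesis by simp
qed

text \<open>Inside a nested stretch the matching is the reflection with constant sum
  \<open>M e + e\<close>; the equations are stated as sums to suit linear arithmetic.\<close>

lemma nested_M:
  assumes "nested M e a" "e < a"
  shows "e \<le> x \<Longrightarrow> x < a \<Longrightarrow> M x + x = M e + e"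
    and "a \<le> e + Suc (M e)"
    and "Suc (M e) - (a - e) \<le> j \<Longrightarrow> j \<le> M e \<Longrightarrow> N j + j = M e + e \<and> e \<le> N j \<and> N j < a"
proof -
  have m: "M x + (x - e) = M e" if "e \<le> x" "x < a" for x using assms that unfolding nested_def by blast
  show m': "M x + x = M e + e" if "e \<le> x" "x < a" for x using m[OF that] that by linarith
  show a: "a \<le> e + Suc (M e)" using m[of "a - 1"] assms by linarith
  show "N j + j = M e + e \<and> e \<le> N j \<and> N j < a" if "Suc (M e) - (a - e) \<le> j" "j \<le> M e"
  proof -
    let ?x = "e + (M e - j)"
    have x: "e \<le> ?x" "?x < a" using that a assms by linarith+
    then have "M ?x = j" using m[of ?x] that by simp
    then have "N j = ?x" using NM by metis
    then show ?thesis using x that by simp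
  qed
qed

text \<open>\<open>c\<close> is the right end of a closed interval starting at \<open>e\<close>. The
  boundaries at \<open>e\<close> and \<open>Suc (M e)\<close> are supplied separately, by the common
  prefix and by \<open>first_difference_closes_fall\<close>.\<close>

definition cut :: "nat \<Rightarrow> nat \<Rightarrow> bool" where
  "cut e c \<longleftrightarrow> e < c \<and> nested M e c \<and> c \<in> B \<and> Suc (M e) - (c - e) \<in> C"

text \<open>An operation of the other kind within either stretch would cause an ascent of
  \<open>M\<close> or \<open>N\<close>, but the nested matching decreases throughout; so
  \<open>R\<close> and \<open>F\<close> are unbroken runs.\<close>

lemma cut_decomposition:
  assumes \<alpha>: "\<alpha> = \<gamma> @ Push s # \<delta>" and e: "e = weight push_size \<gamma>"
    and cut: "cut e a" and T: "Suc (M e) \<in> C"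
  obtains R Y F Z where "\<alpha> = \<gamma> @ R @ Y @ F @ Z" "\<forall>x\<in>set R. is_push x" "\<forall>x\<in>set F. is_pop x"
    "weight push_size R = a - e" "weight pop_size F = a - e"
    "weight pop_size (\<gamma> @ R @ Y) = Suc (M e) - (a - e)"
proof -
  let ?i = "length \<gamma>" and ?d = "Suc (M e) - (a - e)"
  have ea: "e < a" and nest: "nested M e a" and aB: "a \<in> B" and dC: "?d \<in> C"
    using cut by (auto simp: cut_def)
  note nm = nested_M[OF nest ea]
  have i: "?i < length \<alpha>" "\<alpha> ! ?i = Push s" "PB ?i = e" using \<alpha> e by auto
  have s: "0 < s" using arg_pos[OF i(1)] i by simp
  have en: "e < n" using weight_take_le[of push_size "Suc ?i" \<alpha>] i s by (simp add: weight_take_Suc)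
  then have Men: "M e < n" by simp
  have "M (a - 1) \<le> M e" using nm(1)[of "a - 1"] ea by linarith
  then have an: "a - 1 < n" using Men M_less[of "a - 1"] by linarith
  have d: "?d = M (a - 1)" using nm(1)[of "a - 1"] nm(2) ea by linarith
  have Nd: "N ?d = a - 1" using d NM by metis
  obtain p where p: "p < length \<alpha>" "PB (Suc p) = a" "0 < push_size (\<alpha> ! p)"
    using locate_end[of "a - 1" push_size] aB an ea by auto
  obtain k where k: "k < length \<alpha>" "QB k = ?d" "0 < pop_size (\<alpha> ! k)"
    using locate_start[OF dC] d \<open>M (a - 1) \<le> M e\<close> Men weight_pop by (metis le_less_trans)
  obtain l where l: "l < length \<alpha>" "QB (Suc l) = Suc (M e)" "0 < pop_size (\<alpha> ! l)"
    using locate_end[OF T] Men weight_pop by metis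
  have ip: "?i \<le> p"
    using weight_take_mono[of "Suc p" ?i push_size \<alpha>] i p ea by (metis leD not_less_eq_eq)
  have kl: "k \<le> l"
    using weight_take_mono[of "Suc l" k pop_size \<alpha>] k l ea nm(2) by (metis diff_less_mono2 diff_zero leD not_less_eq_eq zero_less_diff zero_less_Suc diff_less)
  \<comment> \<open>The pop step \<open>?d\<close> takes out the push step \<open>a - 1\<close>, the
    last one of the operation \<open>p\<close>, so \<open>k\<close> comes after
    \<open>p\<close>.\<close>
  have pk: "Suc p \<le> k"
  proof (rule ccontr)
    assume "\<not> Suc p \<le> k"
    then have "PB k \<le> PB p" by (intro weight_take_mono) simp
    moreover have "PB (Suc k) = PB k" using k by (cases "\<alpha> ! k") (auto simp: weight_take_Suc)
    moreover have "N ?d < PB (Suc k)" using N_less_PB[of "Suc k" ?d] k by (simp add: weight_take_Suc)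
    moreover have "PB p < a" using p by (simp add: weight_take_Suc)
    ultimately show False using Nd by linarith
  qed
  have R: "is_push (\<alpha> ! q)" if q: "?i \<le> q" "q \<le> p" for q
  proof (rule ccontr)
    assume "\<not> is_push (\<alpha> ! q)"
    then have pop: "is_pop (\<alpha> ! q)" by (cases "\<alpha> ! q") auto
    have "q \<noteq> ?i" using pop i by auto
    then have "PB (Suc ?i) \<le> PB q" using q by (intro weight_take_mono) simp
    then have gt: "e < PB q" using i s by (simp add: weight_take_Suc)
    have "PB q \<le> PB p" using q by (intro weight_take_mono) simp
    then have lt: "PB q < a" using p by (simp add: weight_take_Suc)
    obtain x where x: "PB q = Suc x" using gt by (cases "PB q") auto
    have "M x < M (Suc x)" using M_increasing_over_pop[OF _ pop x] q p by simp
    moreover have "M x + x = M e + e" "M (Suc x) + Suc x = M e + e"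
      using gt lt x by (intro nm(1); linarith)+
    ultimately show False by linarith
  qed
  have F: "is_pop (\<alpha> ! q)" if q: "k \<le> q" "q \<le> l" for q
  proof (rule ccontr)
    assume "\<not> is_pop (\<alpha> ! q)"
    then have push: "is_push (\<alpha> ! q)" by (cases "\<alpha> ! q") auto
    have "q \<noteq> k" using push k by (cases "\<alpha> ! q") auto
    then have "QB (Suc k) \<le> QB q" using q by (intro weight_take_mono) simp
    then have gt: "?d < QB q" using k by (simp add: weight_take_Suc)
    have "QB q \<le> QB l" using q by (intro weight_take_mono) simp
    then have lt: "QB q \<le> M e" using l by (simp add: weight_take_Suc)
    obtain x where x: "QB q = Suc x" using gt by (cases "QB q") auto
    have "N x < N (Suc x)" using N_increasing_over_push[OF _ push x] q l by simp
    moreover have "N x + x = M e + e" "N (Suc x) + Suc x = M e + e"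
      using gt lt x by (intro nm(3)[THEN conjunct1]; linarith)+
    ultimately show False by linarith
  qed
  define seg where "seg i j = drop i (take j \<alpha>)" for i j
  have take_seg: "take i \<alpha> @ seg i j = take j \<alpha>" if "i \<le> j" for i j
    using that by (metis append_take_drop_id min.absorb1 seg_def take_take)
  have set_seg: "\<exists>q. i \<le> q \<and> q < j \<and> x = \<alpha> ! q" if "x \<in> set (seg i j)" "j \<le> length \<alpha>" for i j x
    using that unfolding seg_def by (rule in_set_drop_take)
  let ?R = "seg ?i (Suc p)" and ?Y = "seg (Suc p) k" and ?F = "seg k (Suc l)" and ?Z = "drop (Suc l) \<alpha>"
  have \<gamma>: "take ?i \<alpha> = \<gamma>" using \<alpha> by simp
  have 1: "\<gamma> @ ?R = take (Suc p) \<alpha>" using take_seg[of ?i "Suc p"] ip \<gamma> by simp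
  have 2: "\<gamma> @ ?R @ ?Y = take k \<alpha>" using take_seg[of "Suc p" k] pk 1 by (metis append_assoc)
  have 3: "\<gamma> @ ?R @ ?Y @ ?F = take (Suc l) \<alpha>" using take_seg[of k "Suc l"] kl 2 by (metis append_assoc le_SucI)
  have 4: "\<alpha> = \<gamma> @ ?R @ ?Y @ ?F @ ?Z" using 3 append_take_drop_id[of "Suc l" \<alpha>] by (metis append_assoc)
  have wR: "weight push_size ?R = a - e" using arg_cong[OF 1, of "weight push_size"] p e by simp
  have wY: "weight pop_size (\<gamma> @ ?R @ ?Y) = ?d" using 2 k by simp
  have "weight pop_size ((\<gamma> @ ?R @ ?Y) @ ?F) = Suc (M e)" using 3 l by simp
  then have wF: "weight pop_size ?F = a - e" using wY nm(2) ea by (simp only: map_append sum_list_append)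
  have "\<forall>x\<in>set ?R. is_push x" using set_seg[of _ ?i "Suc p"] R p by fastforce
  moreover have "\<forall>x\<in>set ?F. is_pop x" using set_seg[of _ k "Suc l"] F l by fastforce
  ultimately show ?thesis using that 4 wR wF wY by blast
qed

end

section \<open>Rise-fall pairs\<close>

context wf_seq
begin

text \<open>The push containing a step and the pop containing its match always correspond, so being
  closed under correspondence means that \<open>M\<close> maps the push steps of the pair onto its
  pop steps.\<close>

lemma rf_pair_image:
  assumes rf: "rf_pair \<alpha> i j k l"
  shows "PB i \<le> x \<and> x < PB j \<longleftrightarrow> QB k \<le> M x \<and> M x < QB l"
proof -
  have ij: "i < j" "j \<le> k" "k < l" "l \<le> length \<alpha>"
    and eq1: "{q. \<exists>p\<in>{i..<j}. corresponds \<alpha> p q} = {k..<l}"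
    and eq2: "{p. \<exists>q\<in>{k..<l}. corresponds \<alpha> p q} = {i..<j}"
    using rf by (auto simp: rf_pair_def)
  have pq: "\<exists>p q. corresponds \<alpha> p q \<and> PB p \<le> x \<and> x < PB (Suc p) \<and> QB q \<le> M x \<and> M x < QB (Suc q)"
    if xn: "x < n"
  proof -
    obtain p where p: "p < length \<alpha>" "PB p \<le> x" "x < PB (Suc p)" using xn by (rule locate_op)
    have "M x < weight pop_size \<alpha>" using xn weight_pop by simp
    then obtain q where q: "q < length \<alpha>" "QB q \<le> M x" "M x < QB (Suc q)" by (rule locate_op)
    then show ?thesis using p q corresponds_iff by blast
  qed
  show ?thesis
  proof
    assume x: "PB i \<le> x \<and> x < PB j"
    then have "x < n" using weight_take_le[of push_size j \<alpha>] by linarith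
    then obtain p q where c: "corresponds \<alpha> p q" "PB p \<le> x" "x < PB (Suc p)" "QB q \<le> M x" "M x < QB (Suc q)"
      using pq by blast
    have "p < j" using x c weight_take_mono[of j p push_size \<alpha>] by (meson leD leI less_le_trans le_trans)
    moreover have "i \<le> p" using x c weight_take_mono[of "Suc p" i push_size \<alpha>] by (meson leD le_trans not_less_eq_eq less_le_trans)
    ultimately have "q \<in> {k..<l}" unfolding eq1[symmetric] using c(1) by auto
    then have q: "k \<le> q" "q < l" by auto
    show "QB k \<le> M x \<and> M x < QB l"
      using c q weight_take_mono[of k q pop_size \<alpha>] weight_take_mono[of "Suc q" l pop_size \<alpha>] by simp
  next
    assume x: "QB k \<le> M x \<and> M x < QB l"
    then have "M x < n" using weight_take_le[of pop_size l \<alpha>] weight_pop by linarith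
    then obtain p q where c: "corresponds \<alpha> p q" "PB p \<le> x" "x < PB (Suc p)" "QB q \<le> M x" "M x < QB (Suc q)"
      using pq by auto
    have "q < l" using x c weight_take_mono[of l q pop_size \<alpha>] by (meson leD leI less_le_trans le_trans)
    moreover have "k \<le> q" using x c weight_take_mono[of "Suc q" k pop_size \<alpha>] by (meson leD le_trans not_less_eq_eq less_le_trans)
    ultimately have "p \<in> {i..<j}" unfolding eq2[symmetric] using c(1) by auto
    then have p: "i \<le> p" "p < j" by auto
    show "PB i \<le> x \<and> x < PB j"
      using c p weight_take_mono[of i p push_size \<alpha>] weight_take_mono[of "Suc p" j push_size \<alpha>] by simp
  qed
qed

lemma rf_pairI:
  assumes ord: "i < j" "j \<le> k" "k < l" "l \<le> length \<alpha>"
    and push: "\<And>p. i \<le> p \<Longrightarrow> p < j \<Longrightarrow> is_push (\<alpha> ! p)" and pop: "\<And>q. k \<le> q \<Longrightarrow> q < l \<Longrightarrow> is_pop (\<alpha> ! q)"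
    and image: "\<And>x. PB i \<le> x \<and> x < PB j \<longleftrightarrow> QB k \<le> M x \<and> M x < QB l"
  shows "rf_pair \<alpha> i j k l"
proof -
  have between: "i \<le> p \<and> p < j \<longleftrightarrow> k \<le> q \<and> q < l" if c: "corresponds \<alpha> p q" for p q
  proof -
    obtain x where pl: "p < length \<alpha>" "q < length \<alpha>" and x: "PB p \<le> x" "x < PB (Suc p)" "QB q \<le> M x" "M x < QB (Suc q)"
      using c corresponds_iff by blast
    have "i \<le> p \<and> p < j \<longleftrightarrow> PB i \<le> x \<and> x < PB j"
      using x weight_take_mono[of i p push_size \<alpha>] weight_take_mono[of "Suc p" j push_size \<alpha>]
        weight_take_mono[of "Suc p" i push_size \<alpha>] weight_take_mono[of j p push_size \<alpha>]
      by (meson Suc_leI leD leI le_trans less_le_trans not_less_eq_eq)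
    moreover have "k \<le> q \<and> q < l \<longleftrightarrow> QB k \<le> M x \<and> M x < QB l"
      using x weight_take_mono[of k q pop_size \<alpha>] weight_take_mono[of "Suc q" l pop_size \<alpha>]
        weight_take_mono[of "Suc q" k pop_size \<alpha>] weight_take_mono[of l q pop_size \<alpha>]
      by (meson Suc_leI leD leI le_trans less_le_trans not_less_eq_eq)
    ultimately show ?thesis using image by simp
  qed
  have exq: "\<exists>q. corresponds \<alpha> p q" if p: "i \<le> p" "p < j" for p
  proof -
    have pl: "p < length \<alpha>" using p ord by simp
    have lt: "PB p < PB (Suc p)" using push[OF p] arg_pos[OF pl] pl by (cases "\<alpha> ! p") (auto simp: weight_take_Suc)
    then have "PB p < n" using weight_take_le[of push_size "Suc p" \<alpha>] by linarith
    then have "M (PB p) < weight pop_size \<alpha>" using weight_pop by simp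
    then obtain q where "q < length \<alpha>" "QB q \<le> M (PB p)" "M (PB p) < QB (Suc q)" by (rule locate_op)
    then show ?thesis using corresponds_iff pl lt by blast
  qed
  have exp: "\<exists>p. corresponds \<alpha> p q" if q: "k \<le> q" "q < l" for q
  proof -
    have ql: "q < length \<alpha>" using q ord by simp
    have lt: "QB q < QB (Suc q)" using pop[OF q] arg_pos[OF ql] ql by (cases "\<alpha> ! q") (auto simp: weight_take_Suc)
    then have "QB q < n" using weight_take_le[of pop_size "Suc q" \<alpha>] weight_pop by linarith
    then have "N (QB q) < n" by simp
    then obtain p where "p < length \<alpha>" "PB p \<le> N (QB q)" "N (QB q) < PB (Suc p)" by (rule locate_op)
    then show ?thesis using corresponds_iff ql lt by (metis MN le_refl)
  qed
  have "{q. \<exists>p\<in>{i..<j}. corresponds \<alpha> p q} = {k..<l}"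
  proof (intro equalityI subsetI)
    fix q assume "q \<in> {q. \<exists>p\<in>{i..<j}. corresponds \<alpha> p q}"
    then obtain p where "i \<le> p" "p < j" "corresponds \<alpha> p q" by auto
    then show "q \<in> {k..<l}" using between[of p q] by simp
  next
    fix q assume "q \<in> {k..<l}"
    moreover from this obtain p where "corresponds \<alpha> p q" using exp[of q] by auto
    ultimately show "q \<in> {q. \<exists>p\<in>{i..<j}. corresponds \<alpha> p q}" using between[of p q] by auto
  qed
  moreover have "{p. \<exists>q\<in>{k..<l}. corresponds \<alpha> p q} = {i..<j}"
  proof (intro equalityI subsetI)
    fix p assume "p \<in> {p. \<exists>q\<in>{k..<l}. corresponds \<alpha> p q}"
    then obtain q where "k \<le> q" "q < l" "corresponds \<alpha> p q" by auto
    then show "p \<in> {i..<j}" using between[of p q] by simp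
  next
    fix p assume "p \<in> {i..<j}"
    moreover from this obtain q where "corresponds \<alpha> p q" using exq[of p] by auto
    ultimately show "p \<in> {p. \<exists>q\<in>{k..<l}. corresponds \<alpha> p q}" using between[of p q] by auto
  qed
  ultimately show ?thesis using ord push pop by (auto simp: rf_pair_def)
qed

text \<open>A smaller pair has an end strictly inside the stretch. Nesting puts its push end and its
  pop end at mirrored positions, so this end is a smaller cut from \<open>e\<close>, even if the
  smaller pair starts after \<open>e\<close>.\<close>

lemma rise_fallI:
  assumes \<alpha>: "\<alpha> = X @ R @ Y @ F @ Z"
    and R: "\<forall>x\<in>set R. is_push x" and F: "\<forall>x\<in>set F. is_pop x"
    and e: "e = weight push_size X" and wR: "weight push_size R = a - e" and wF: "weight pop_size F = a - e"
    and wY: "weight pop_size (X @ R @ Y) = Suc (M e) - (a - e)"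
    and cut: "cut e a" and min: "\<And>c. c < a \<Longrightarrow> \<not> cut e c"
  shows "rise_fall \<alpha> (length X) (length X + length R) (length X + length R + length Y)
    (length X + length R + length Y + length F)"
proof -
  let ?i = "length X"
  let ?j = "?i + length R"
  let ?k = "?j + length Y"
  let ?l = "?k + length F"
  let ?d = "\<lambda>c. Suc (M e) - (c - e)"
  have ea: "e < a" and nest: "nested M e a" using cut by (auto simp: cut_def)
  note nm = nested_M[OF nest ea]
  have tk: "take ?i \<alpha> = X" "take ?j \<alpha> = X @ R" "take ?k \<alpha> = X @ R @ Y" "take ?l \<alpha> = X @ R @ Y @ F"
    using \<alpha> by simp_all
  have wts: "PB ?i = e" "PB ?j = a" "QB ?k = ?d a" "QB ?l = Suc (M e)"
    using tk e wR wF wY ea nm(2) by simp_all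
  have push: "is_push (\<alpha> ! p)" if p: "?i \<le> p" "p < ?j" for p
  proof -
    obtain u where u: "p = ?i + u" "u < length R"
      using p by (metis le_Suc_ex nat_add_left_cancel_less)
    then have "\<alpha> ! p = R ! u" using \<alpha> by (simp add: nth_append)
    then show ?thesis using R u by simp
  qed
  have pop: "is_pop (\<alpha> ! q)" if q: "?k \<le> q" "q < ?l" for q
  proof -
    obtain u where u: "q = ?k + u" "u < length F"
      using q by (metis le_Suc_ex nat_add_left_cancel_less)
    have "((X @ R @ Y) @ F @ Z) ! (length (X @ R @ Y) + u) = F ! u"
      using u(2) by (simp only: nth_append_length_plus nth_append_left)
    moreover have "\<alpha> = (X @ R @ Y) @ F @ Z" "length (X @ R @ Y) + u = q" using \<alpha> u by simp_all
    ultimately have "\<alpha> ! q = F ! u" by metis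
    then show ?thesis using F u by simp
  qed
  have image: "PB ?i \<le> x \<and> x < PB ?j \<longleftrightarrow> QB ?k \<le> M x \<and> M x < QB ?l" for x
  proof
    assume "PB ?i \<le> x \<and> x < PB ?j"
    then show "QB ?k \<le> M x \<and> M x < QB ?l" using nm(1)[of x] nm(2) wts by linarith
  next
    assume "QB ?k \<le> M x \<and> M x < QB ?l"
    then show "PB ?i \<le> x \<and> x < PB ?j" using nm(3)[of "M x"] wts by simp
  qed
  have ne: "R \<noteq> []" "F \<noteq> []" using wR wF ea by auto
  have rf: "rf_pair \<alpha> ?i ?j ?k ?l"
    by (rule rf_pairI[OF _ _ _ _ push pop image]) (use ne \<alpha> in auto)
  have False
    if rf': "rf_pair \<alpha> i' j' k' l'" and sub: "?i \<le> i'" "j' \<le> ?j" "(i', j') \<noteq> (?i, ?j)" "?k \<le> k'" "l' \<le> ?l" for i' j' k' l'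
  proof -
    have ij: "i' < j'" using rf' by (simp add: rf_pair_def)
    note im = rf_pair_image[OF rf']
    have mono: "PB p < PB q" if "?i \<le> p" "p < q" "q \<le> ?j" for p q
    proof -
      have "p < length \<alpha>" using that \<alpha> by simp
      then have "PB p < PB (Suc p)"
        using push[of p] arg_pos[of p] that by (cases "\<alpha> ! p") (auto simp: weight_take_Suc)
      also have "\<dots> \<le> PB q" using that by (intro weight_take_mono) simp
      finally show ?thesis .
    qed
    have xy: "PB i' < PB j'" using mono sub ij by simp
    have ge: "e \<le> PB i'" using weight_take_mono[OF sub(1), of push_size \<alpha>] wts by simp
    have le: "PB j' \<le> a" using weight_take_mono[OF sub(2), of push_size \<alpha>] wts by simp
    have nest': "nested M e c" if "c \<le> a" for c using nest that unfolding nested_def by auto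
    show False
    proof (cases "i' = ?i")
      case False
      then have gt: "e < PB i'" using mono[of ?i i'] sub ij wts by simp
      then obtain x where x: "PB i' = Suc x" by (cases "PB i'") auto
      have M1: "M (Suc x) + Suc x = M e + e" using ge xy le x by (intro nm(1)) linarith+
      have M2: "M x + x = M e + e" using gt xy le x by (intro nm(1)) linarith+
      have "QB k' \<le> M (Suc x) \<and> M (Suc x) < QB l'" using im[of "Suc x"] xy x by simp
      moreover have "\<not> (QB k' \<le> M x \<and> M x < QB l')" using im[of x] x by simp
      \<comment> \<open>\<open>M x\<close> is just one more than \<open>M (Suc x)\<close>, and only
        the latter lies in the pop interval, which therefore ends at \<open>M x\<close>, the mirror
        image of \<open>PB i'\<close>.\<close>
      ultimately have "QB l' = M x" using M1 M2 by linarith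
      moreover have "?d (PB i') = M x" using M2 x gt by linarith
      ultimately have "?d (PB i') \<in> C" using weight_take_in_boundaries by metis
      then have "cut e (PB i')" unfolding cut_def
        using gt nest' xy le weight_take_in_boundaries by simp
      then show False using min xy le by simp
    next
      case True
      then have lt: "PB j' < a" using mono[of j' ?j] sub ij wts by auto
      obtain y where y: "PB j' = Suc y" using xy by (cases "PB j'") auto
      have M1: "M (Suc y) + Suc y = M e + e" using ge xy lt y by (intro nm(1)) linarith+
      have M2: "M y + y = M e + e" using ge xy lt y by (intro nm(1)) linarith+
      have "QB k' \<le> M y \<and> M y < QB l'" using im[of y] xy y by simp
      moreover have "\<not> (QB k' \<le> M (Suc y) \<and> M (Suc y) < QB l')" using im[of "Suc y"] y by simp
      ultimately have "QB k' = M y" using M1 M2 by linarith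
      moreover have "?d (PB j') = M y" using M2 y ge xy by linarith
      ultimately have "?d (PB j') \<in> C" using weight_take_in_boundaries by metis
      moreover have "e < PB j'" using ge xy by linarith
      ultimately have "cut e (PB j')" unfolding cut_def
        using nest' le weight_take_in_boundaries by simp
      then show False using min lt by simp
    qed
  qed
  then show ?thesis unfolding rise_fall_def using rf by blast
qed

end

section \<open>Two sequences with the same path and the same permutation\<close>

locale same_path = A: wf_seq \<alpha> + B: wf_seq \<beta> for \<alpha> \<beta> +
  assumes expand_eq: "expand \<alpha> = expand \<beta>" and perm_eq: "perm_of \<alpha> = perm_of \<beta>"
begin

lemma n_eq: "B.n = A.n"
  using expand_eq weight_expand by metis

lemma unit_out_eq: "unit_out \<beta> = unit_out \<alpha>"
  using expand_eq unit_run_expand unfolding unit_out_def by metis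

lemma N_eq: "B.N = A.N"
  by (rule ext) (simp add: A.N_def B.N_def n_eq unit_out_eq)

lemma M_eq: "B.M = A.M"
  by (simp add: A.M_def B.M_def N_eq)

lemma out_at_eq: "A.out_at j = B.out_at j"
proof (cases "j < A.n")
  case True
  have "map (\<lambda>j. Suc (A.out_at j)) [0..<A.n] = map (\<lambda>j. Suc (B.out_at j)) [0..<A.n]"
    using perm_eq unfolding A.perm_of_eq B.perm_of_eq n_eq by simp
  then show ?thesis using True by simp
next
  case False
  then show ?thesis using A.out_at_ge B.out_at_ge n_eq by simp
qed

sublocale two_blockings A.n A.M A.N A.B B.B A.C B.C
  using A.blocking_push A.blocking_pop B.blocking_push B.blocking_pop out_at_eq
  by unfold_locales (auto simp: n_eq M_eq N_eq A.out_at_def B.out_at_def)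

lemma sym: "same_path \<beta> \<alpha>"
  using expand_eq perm_eq by unfold_locales auto

lemma block_rev_common_prefix:
  assumes "\<alpha> = \<gamma> @ \<alpha>'" "\<beta> = \<gamma> @ \<beta>'" "i < weight push_size \<gamma>"
  shows "block_rev A.B i = block_rev B.B i"
proof (rule block_rev_cong[OF A.bounds(1), of 0 "weight push_size \<gamma>"])
  show "0 \<in> A.B" using A.bounds(1) by (simp add: boundary_set_def)
  show "weight push_size \<gamma> \<in> A.B" using assms(1) weight_take_in_boundaries[of push_size "length \<gamma>" \<alpha>] by simp
  show "x \<in> A.B \<longleftrightarrow> x \<in> B.B" if "x \<le> weight push_size \<gamma>" for x
    using assms(1,2) boundaries_append_le[OF that] by simp
qed (use assms in auto)

text \<open>Slot \<open>?j\<close> receives the lowest element of the popped block. It was pushed in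
  the common prefix, where the push reversals agree, so the equal output fixes the depth to which
  the block reaches.\<close>

lemma no_first_pop_difference:
  assumes \<alpha>: "\<alpha> = \<gamma> @ Pop b # \<alpha>'" and \<beta>: "\<beta> = \<gamma> @ Pop b' # \<beta>'"
  shows "b = b'"
proof -
  let ?k = "length \<gamma>" and ?j = "weight pop_size \<gamma>"
  have a: "?k < length \<alpha>" "\<alpha> ! ?k = Pop b" "take ?k \<alpha> = \<gamma>" "take (Suc ?k) \<alpha> = \<gamma> @ [Pop b]" using \<alpha> by auto
  have bb: "?k < length \<beta>" "\<beta> ! ?k = Pop b'" "take ?k \<beta> = \<gamma>" "take (Suc ?k) \<beta> = \<gamma> @ [Pop b']" using \<beta> by auto
  have pos: "0 < b" "0 < b'" using A.arg_pos[OF a(1)] B.arg_pos[OF bb(1)] a bb by auto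
  have "is_block A.C ?j (?j + b)" using is_block_op[OF a(1), of pop_size] a pos by simp
  then have r: "block_rev A.C ?j = ?j + (b - 1)" using pos by (simp add: block_rev_block)
  have "is_block B.C ?j (?j + b')" using is_block_op[OF bb(1), of pop_size] bb pos by simp
  then have r': "block_rev B.C ?j = ?j + (b' - 1)" using pos by (simp add: block_rev_block)
  have "A.N (?j + (b - 1)) < weight push_size \<gamma>"
    using A.N_less_PB[of "Suc ?k" "?j + (b - 1)"] a pos by simp
  then have "block_rev B.B (A.N (?j + (b - 1))) = block_rev A.B (A.N (?j + (b - 1)))"
    using block_rev_common_prefix[OF \<alpha> \<beta>] by simp
  also have "\<dots> = block_rev B.B (A.N (?j + (b' - 1)))" using same_out[of ?j] r r' by simp
  finally have "A.N (?j + (b - 1)) = A.N (?j + (b' - 1))" using block_rev_inject[OF bounds(2)] by simp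
  then have "?j + (b - 1) = ?j + (b' - 1)" using A.MN by metis
  then show ?thesis using pos by simp
qed

lemma common_cut_at_push:
  assumes \<alpha>: "\<alpha> = \<gamma> @ Push s # \<alpha>'" and \<beta>: "\<beta> = \<gamma> @ Push s' # \<beta>'" and ne: "s \<noteq> s'"
    and e: "e = weight push_size \<gamma>"
  shows "Suc (A.M e) \<in> A.C" "Suc (A.M e) \<in> B.C" "\<exists>c. A.cut e c \<and> B.cut e c"
proof -
  let ?k = "length \<gamma>"
  have a: "?k < length \<alpha>" "\<alpha> ! ?k = Push s" "take ?k \<alpha> = \<gamma>" "take (Suc ?k) \<alpha> = \<gamma> @ [Push s]" using \<alpha> by auto
  have bb: "?k < length \<beta>" "\<beta> ! ?k = Push s'" "take ?k \<beta> = \<gamma>" "take (Suc ?k) \<beta> = \<gamma> @ [Push s']" using \<beta> by auto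
  have pos: "0 < s" "0 < s'" using A.arg_pos[OF a(1)] B.arg_pos[OF bb(1)] a bb by auto
  have "is_block A.B e (e + s)" using is_block_op[OF a(1), of push_size] a pos e by simp
  then have r: "block_rev A.B e = e + (s - 1)" using pos by (simp add: block_rev_block)
  have "is_block B.B e (e + s')" using is_block_op[OF bb(1), of push_size] bb pos e by simp
  then have r': "block_rev B.B e = e + (s' - 1)" using pos by (simp add: block_rev_block)
  \<comment> \<open>The reversals send \<open>e\<close> to the last steps of blocks of different
    sizes.\<close>
  have diff: "block_rev A.B e \<noteq> block_rev B.B e" using r r' ne pos by simp
  show "Suc (A.M e) \<in> A.C" "Suc (A.M e) \<in> B.C"
    using first_difference_closes_fall[of e] block_rev_common_prefix[OF \<alpha> \<beta>] diff e by blast+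
  obtain c where "e < c" "nested A.M e c" "c \<in> A.B" "c \<in> B.B"
    "Suc (A.M e) - (c - e) \<in> A.C" "Suc (A.M e) - (c - e) \<in> B.C"
    by (rule common_cut[OF diff])
  then show "\<exists>c. A.cut e c \<and> B.cut e c" unfolding A.cut_def B.cut_def M_eq by blast
qed

text \<open>The minimal pair of \<open>\<beta>\<close> is replaced by the one of \<open>\<alpha>\<close>, filled up with unit steps on the upper side. If
  there is something to fill up, then the pair of \<open>\<beta>\<close> is a single push and a single pop of the same
  size, which reverse the same block and hence act as unit steps.\<close>

lemma replace_rise_fall:
  assumes \<alpha>: "\<alpha> = \<gamma> @ Push s # \<alpha>'" and \<beta>: "\<beta> = \<gamma> @ Push s' # \<beta>'" and ne: "s \<noteq> s'"
    and e: "e = weight push_size \<gamma>"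
    and a: "A.cut e a" and b: "B.cut e b" and bmin: "\<And>c. c < b \<Longrightarrow> \<not> B.cut e c"
    and ab: "a \<le> b"
  obtains \<beta>'' R where "rf_step \<beta> \<beta>''" "expand \<beta>'' = expand \<beta>" "0 < weight push_size R"
    "\<exists>\<delta>. \<alpha> = (\<gamma> @ R) @ \<delta>" "\<exists>\<delta>. \<beta>'' = (\<gamma> @ R) @ \<delta>"
proof -
  note T = common_cut_at_push(1,2)[OF \<alpha> \<beta> ne e]
  let ?t = "A.M e"
  let ?da = "Suc ?t - (a - e)" and ?db = "Suc ?t - (b - e)"
  obtain R1 Y1 F1 Z1 where 1: "\<alpha> = \<gamma> @ R1 @ Y1 @ F1 @ Z1"
    and R1: "\<forall>x\<in>set R1. is_push x" and F1: "\<forall>x\<in>set F1. is_pop x"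
    and w1: "weight push_size R1 = a - e" "weight pop_size F1 = a - e" "weight pop_size (\<gamma> @ R1 @ Y1) = ?da"
    by (rule A.cut_decomposition[OF \<alpha> e a T(1)])
  obtain R2 Y2 F2 Z2 where 2: "\<beta> = \<gamma> @ R2 @ Y2 @ F2 @ Z2"
    and R2: "\<forall>x\<in>set R2. is_push x" and F2: "\<forall>x\<in>set F2. is_pop x"
    and w2: "weight push_size R2 = b - e" "weight pop_size F2 = b - e" "weight pop_size (\<gamma> @ R2 @ Y2) = ?db"
    using B.cut_decomposition[OF \<beta> e b] T(2) unfolding M_eq by blast
  have rf: "rise_fall \<beta> (length \<gamma>) (length \<gamma> + length R2) (length \<gamma> + length R2 + length Y2)
      (length \<gamma> + length R2 + length Y2 + length F2)"
    by (rule B.rise_fallI[OF 2 R2 F2 e w2(1,2) _ b bmin]) (use w2(3) M_eq in auto)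
  \<comment> \<open>Later pushes leave earlier, so the unit pushes for \<open>[a,b)\<close> follow
    \<open>R1\<close>, while their unit pops precede \<open>F1\<close>.\<close>
  define R where "R = R1 @ replicate (b - a) (Push 1)"
  define F where "F = replicate (b - a) (Pop 1) @ F1"
  define \<beta>'' where "\<beta>'' = \<gamma> @ R @ Y2 @ F @ Z2"
  have ea: "e < a" and eb: "e < b" using a b by (auto simp: A.cut_def B.cut_def)
  have nest: "nested A.M e b" using b M_eq by (simp add: B.cut_def)
  note nm = A.nested_M[OF nest eb]
  have R: "\<forall>x\<in>set R. is_push x" and F: "\<forall>x\<in>set F. is_pop x" using R1 F1 by (auto simp: R_def F_def)
  have wR: "weight push_size R = b - e" and wF: "weight pop_size F = b - e"
    using w1 ab ea by (simp_all add: R_def F_def sum_list_replicate)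
  have expand: "expand \<beta>'' = expand \<beta>"
    using expand_pushes[OF R] expand_pushes[OF R2] expand_pops[OF F] expand_pops[OF F2] wR wF w2
    unfolding \<beta>''_def by (subst 2) simp
  have args: "\<forall>x\<in>set \<beta>''. 1 \<le> op_arg x"
  proof -
    have "set \<beta>'' \<subseteq> set \<alpha> \<union> set \<beta> \<union> {Push 1, Pop 1}"
      unfolding \<beta>''_def R_def F_def by (subst 1, subst 2) auto
    moreover have "\<forall>x\<in>set \<alpha> \<union> set \<beta> \<union> {Push 1, Pop 1}. 1 \<le> op_arg x"
      using A.wf B.wf unfolding well_formed_def by auto
    ultimately show ?thesis by blast
  qed
  have wf: "well_formed \<beta>''" by (rule well_formed_expand_cong[OF B.wf expand args])
  interpret D: wf_seq \<beta>'' by (rule wf_seq.intro[OF wf])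
  have Dn: "D.n = A.n" using expand weight_expand n_eq by metis
  have "unit_out \<beta>'' = unit_out \<alpha>" using expand expand_eq unit_run_expand unfolding unit_out_def by metis
  then have DN: "D.N = A.N" by (intro ext) (simp add: A.N_def D.N_def Dn)
  have bd: "boundary_set A.n D.B" "boundary_set A.n D.C" using D.bounds Dn by auto
  have wp: "weight pop_size R = 0" "weight pop_size R2 = 0" "weight push_size F = 0" "weight push_size F2 = 0"
    using weight_zero R R2 F F2 by blast+
  have wts: "weight push_size (\<gamma> @ R) = b" "weight push_size (\<gamma> @ R2) = b"
    "weight pop_size (\<gamma> @ R @ Y2) = ?db"
    using e wR w2 eb wp unfolding map_append sum_list_append by linarith+
  have wts': "weight pop_size (\<gamma> @ R @ Y2 @ F) = Suc ?t" "weight pop_size (\<gamma> @ R2 @ Y2 @ F2) = Suc ?t"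
    using wts(3) w2(2,3) wF eb nm(2) unfolding map_append sum_list_append by linarith+
  note pre = prefix_weight_in_boundaries
  have eD: "e \<in> D.B" "b \<in> D.B" and dD: "?db \<in> D.C" "Suc ?t \<in> D.C"
    using pre[of push_size \<gamma> "R @ Y2 @ F @ Z2"] pre[of push_size "\<gamma> @ R" "Y2 @ F @ Z2"]
      pre[of pop_size "\<gamma> @ R @ Y2" "F @ Z2"] pre[of pop_size "\<gamma> @ R @ Y2 @ F" Z2]
    unfolding wts wts' e[symmetric] \<beta>''_def append_assoc by blast+
  have eB: "e \<in> B.B" unfolding e by (subst 2) (rule pre)
  have eA: "e \<in> A.B" unfolding e by (subst 1) (rule pre)
  have bB: "b \<in> B.B" "?db \<in> B.C" using b M_eq by (auto simp: B.cut_def)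
  have aA: "a \<in> A.B" "?da \<in> A.C" using a by (auto simp: A.cut_def)
  have da: "?da = ?db + (b - a)" using ab ea nm(2) by linarith

  \<comment> \<open>The boundaries of the new sequence are those of \<open>\<beta>\<close> outside
    the replaced stretches, those of \<open>\<alpha>\<close> along \<open>R1\<close> and
    \<open>F1\<close>, and all positions along the filling.\<close>
  have low: "x \<in> D.B \<longleftrightarrow> x \<in> B.B" if "x \<le> e" for x
    using boundaries_append_le[of x push_size \<gamma>] that e unfolding \<beta>''_def by (subst 2) simp
  have high: "x \<in> D.B \<longleftrightarrow> x \<in> B.B" if "b \<le> x" for x
  proof -
    obtain y where x: "x = b + y" using \<open>b \<le> x\<close> le_Suc_ex by blast
    have "x \<in> boundaries push_size ((\<gamma> @ R) @ Y2 @ F @ Z2) \<longleftrightarrow> y \<in> boundaries push_size (Y2 @ F @ Z2)"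
      "x \<in> boundaries push_size ((\<gamma> @ R2) @ Y2 @ F2 @ Z2) \<longleftrightarrow> y \<in> boundaries push_size (Y2 @ F2 @ Z2)"
      using x wts boundaries_append_add by metis+
    moreover have "boundaries push_size (Y2 @ F @ Z2) = boundaries push_size (Y2 @ F2 @ Z2)"
      using boundaries_append_cong boundaries_weightless wp by metis
    ultimately show ?thesis unfolding \<beta>''_def by (subst 2) simp
  qed
  have mid: "x \<in> D.B \<longleftrightarrow> x \<in> A.B" if "x \<le> a" for x
  proof -
    have "x \<le> weight push_size (\<gamma> @ R1)" using that e w1 ea by simp
    then have "x \<in> boundaries push_size ((\<gamma> @ R1) @ S) \<longleftrightarrow> x \<in> boundaries push_size (\<gamma> @ R1)" for S
      by (rule boundaries_append_le)
    from this[of "replicate (b - a) (Push 1) @ Y2 @ F @ Z2"] this[of "Y1 @ F1 @ Z1"]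
    show ?thesis unfolding \<beta>''_def R_def by (subst 1) simp
  qed
  have units: "x \<in> D.B" if "a \<le> x" "x \<le> b" for x
  proof -
    obtain y where x: "x = a + y" using \<open>a \<le> x\<close> le_Suc_ex by blast
    have "weight push_size (\<gamma> @ R1) = a" using e w1 ea by simp
    then have "x \<in> boundaries push_size ((\<gamma> @ R1) @ replicate (b - a) (Push 1) @ Y2 @ F @ Z2)"
      using x that boundaries_append_add boundaries_replicate[of push_size "Push 1" y "b - a"]
      by (metis le_diff_conv2 add.commute ab push_size.simps(1) diff_add_inverse diff_le_mono)
    then show ?thesis unfolding \<beta>''_def R_def by simp
  qed
  have lowC: "x \<in> D.C \<longleftrightarrow> x \<in> B.C" if "x \<le> ?db" for x
  proof -
    have "x \<le> weight pop_size (\<gamma> @ R @ Y2)" "x \<le> weight pop_size (\<gamma> @ R2 @ Y2)" using that w2(3) wts(3) by simp_all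
    then have "x \<in> boundaries pop_size ((\<gamma> @ R @ Y2) @ F @ Z2) \<longleftrightarrow> x \<in> boundaries pop_size (\<gamma> @ R @ Y2)"
      "x \<in> boundaries pop_size ((\<gamma> @ R2 @ Y2) @ F2 @ Z2) \<longleftrightarrow> x \<in> boundaries pop_size (\<gamma> @ R2 @ Y2)"
      using boundaries_append_le by blast+
    moreover have "boundaries pop_size (\<gamma> @ R @ Y2) = boundaries pop_size (\<gamma> @ R2 @ Y2)"
      using boundaries_append_cong boundaries_weightless wp by metis
    ultimately show ?thesis unfolding \<beta>''_def by (subst 2) simp
  qed
  have highC: "x \<in> D.C \<longleftrightarrow> x \<in> B.C" if "Suc ?t \<le> x" for x
  proof -
    obtain y where x: "x = Suc ?t + y" using \<open>Suc ?t \<le> x\<close> le_Suc_ex by blast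
    have "x \<in> boundaries pop_size ((\<gamma> @ R @ Y2 @ F) @ Z2) \<longleftrightarrow> y \<in> boundaries pop_size Z2"
      "x \<in> boundaries pop_size ((\<gamma> @ R2 @ Y2 @ F2) @ Z2) \<longleftrightarrow> y \<in> boundaries pop_size Z2"
      using x wts' boundaries_append_add by metis+
    then show ?thesis unfolding \<beta>''_def by (subst 2) simp
  qed
  have midC: "x \<in> D.C \<longleftrightarrow> x \<in> A.C" if "?da \<le> x" "x \<le> Suc ?t" for x
  proof -
    obtain y where x: "x = ?da + y" using \<open>?da \<le> x\<close> le_Suc_ex by blast
    have y: "y \<le> weight pop_size F1" using x that w1 ab ea nm(2) by linarith
    have "weight pop_size (\<gamma> @ R @ Y2 @ replicate (b - a) (Pop 1)) = ?da"
      using wts(3) da by (simp add: sum_list_replicate)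
    then have "x \<in> boundaries pop_size ((\<gamma> @ R @ Y2 @ replicate (b - a) (Pop 1)) @ F1 @ Z2) \<longleftrightarrow>
        y \<in> boundaries pop_size (F1 @ Z2)"
      "x \<in> boundaries pop_size ((\<gamma> @ R1 @ Y1) @ F1 @ Z1) \<longleftrightarrow> y \<in> boundaries pop_size (F1 @ Z1)"
      using x w1(3) boundaries_append_add by metis+
    then show ?thesis using boundaries_append_le[OF y] unfolding \<beta>''_def F_def by (subst 1) simp
  qed
  have unitsC: "x \<in> D.C" if "?db \<le> x" "x \<le> ?da" for x
  proof -
    obtain y where x: "x = ?db + y" using \<open>?db \<le> x\<close> le_Suc_ex by blast
    then have y: "y \<le> b - a" using that da by linarith
    have "x \<in> boundaries pop_size ((\<gamma> @ R @ Y2) @ replicate (b - a) (Pop 1) @ F1 @ Z2)"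
      using x y wts(3) boundaries_append_add boundaries_replicate[of pop_size "Pop 1" y "b - a"] by (metis pop_size.simps(2))
    then show ?thesis unfolding \<beta>''_def F_def by simp
  qed

  have nB: "0 \<in> D.B" "0 \<in> D.C" "{A.n..} \<subseteq> D.B" "{A.n..} \<subseteq> D.C" using bd by (auto simp: boundary_set_def)
  have outB: "block_rev D.B i = block_rev B.B i" if "i < e \<or> b \<le> i" for i
    using that
  proof
    assume "i < e"
    then show ?thesis using block_rev_cong[OF bd(1) nB(1) eD(1), of B.B i] low by simp
  next
    assume "b \<le> i"
    moreover have "Suc i + A.n \<in> D.B" using nB(3) by auto
    ultimately show ?thesis using block_rev_cong[OF bd(1) eD(2), of "Suc i + A.n" B.B i] high by simp
  qed
  have inB: "block_rev D.B i = block_rev A.B i" if "e \<le> i" "i < a" for i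
    using block_rev_cong[OF bd(1) eD(1) units[of a], of A.B i] mid that ab by simp
  have unitB: "block_rev D.B i = i" if "a \<le> i" "i < b" for i
  proof -
    have "is_block D.B i (Suc i)" using units that by (simp add: is_block_def)
    then show ?thesis by (simp add: block_rev_block)
  qed
  have outC: "block_rev D.C i = block_rev B.C i" if "i < ?db \<or> Suc ?t \<le> i" for i
    using that
  proof
    assume "i < ?db"
    then show ?thesis using block_rev_cong[OF bd(2) nB(2) dD(1), of B.C i] lowC by simp
  next
    assume "Suc ?t \<le> i"
    moreover have "Suc i + A.n \<in> D.C" using nB(4) by auto
    ultimately show ?thesis using block_rev_cong[OF bd(2) dD(2), of "Suc i + A.n" B.C i] highC by simp
  qed
  have inC: "block_rev D.C i = block_rev A.C i" if "?da \<le> i" "i < Suc ?t" for i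
    using block_rev_cong[OF bd(2) unitsC[of ?da] dD(2), of A.C i] midC that da by simp
  have unitC: "block_rev D.C i = i" if "?db \<le> i" "i < ?da" for i
  proof -
    have "is_block D.C i (Suc i)" using unitsC that by (simp add: is_block_def)
    then show ?thesis by (simp add: block_rev_block)
  qed

  have out: "D.out_at j = B.out_at j" for j
  proof -
    \<comment> \<open>Slots outside the replaced fall are filled as by \<open>\<beta>\<close>, slots
      of \<open>F1\<close> as by \<open>\<alpha>\<close>, which has the same output; the filling
      remains.\<close>
    consider "j < ?db \<or> Suc ?t \<le> j" | "?da \<le> j" "j < Suc ?t" | "?db \<le> j" "j < ?da" by linarith
    then show ?thesis
    proof cases
      case 1
      let ?j = "block_rev B.C j"
      have "?j < ?db \<or> Suc ?t \<le> ?j"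
        using 1 block_rev_less_iff[OF bounds(4) bB(2)] block_rev_less_iff[OF bounds(4) T(2)] by (meson not_le)
      moreover have "?db \<le> ?j \<and> ?j < Suc ?t" if "e \<le> A.N ?j" "A.N ?j < b"
        using nm(1)[OF that] that nm(2) A.MN[of ?j] by (simp only: A.MN) linarith
      ultimately have "A.N ?j < e \<or> b \<le> A.N ?j" by (meson leD leI)
      then show ?thesis using outC[OF 1] outB unfolding D.out_at_def B.out_at_def DN N_eq by simp
    next
      case 2
      let ?j = "block_rev A.C j"
      have j: "?da \<le> ?j" "?j < Suc ?t"
        using 2 block_rev_less_iff[OF bounds(3) aA(2)] block_rev_less_iff[OF bounds(3) T(1)] by (meson not_le)+
      have "nested A.M e a" using a by (simp add: A.cut_def)
      then have "e \<le> A.N ?j" "A.N ?j < a" using A.nested_M(3)[OF _ ea, of ?j] j by simp_all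
      then have "D.out_at j = A.out_at j"
        using inC[OF 2] inB unfolding D.out_at_def A.out_at_def DN by simp
      then show ?thesis using out_at_eq by simp
    next
      case 3
      then have lt: "a < b" using da by linarith
      have "\<not> (c \<in> B.B \<and> Suc ?t - (c - e) \<in> B.C)" if "e < c" "c < b" for c
      proof -
        have "nested A.M e c" using nest that unfolding nested_def by auto
        then show ?thesis using bmin[OF that(2)] that(1) unfolding B.cut_def M_eq by blast
      qed
      then have bl: "is_block B.B e b" "is_block B.C ?db (Suc ?t)"
        using smaller_cut_single_block[OF ea lt nest eA aA(1) T(1) aA(2) eB bB(1) T(2) bB(2)] by blast+
      have Nj: "A.N j + j = ?t + e" "e \<le> A.N j" "A.N j < b" using nm(3)[of j] 3 by simp_all
      have "a \<le> A.N j" using Nj 3 lt ea nm(2) by linarith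
      then have "D.out_at j = A.N j" using unitC[OF 3] unitB Nj unfolding D.out_at_def DN by simp
      moreover
      \<comment> \<open>In \<open>\<beta>\<close> the slot is mirrored in the pop block, matched,
        and the result mirrored in the push block. The matching is a reflection as well, so the
        mirrorings cancel and leave \<open>A.N j\<close>.\<close>
      define j' where j': "j' = ?db + Suc ?t - 1 - j"
      have rj: "block_rev B.C j = j'" using block_rev_block[OF bl(2), of j] 3 j' by simp
      have j: "?db \<le> j'" "j' \<le> ?t" "j + j' = ?db + ?t" using 3 j' by linarith+
      then have Nj': "A.N j' + j' = ?t + e" "e \<le> A.N j'" "A.N j' < b" using nm(3)[of j'] by simp_all
      then have "B.out_at j = e + b - 1 - A.N j'"
        using block_rev_block[OF bl(1)] rj unfolding B.out_at_def N_eq by simp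
      moreover have "?db + b = Suc ?t + e" using nm(2) eb by linarith
      then have "e + b - 1 - A.N j' = A.N j" using Nj(1) Nj'(1) j(3) by linarith
      ultimately show ?thesis by simp
    qed
  qed
  then have "perm_of \<beta>'' = perm_of \<beta>" unfolding D.perm_of_eq B.perm_of_eq Dn n_eq by simp
  moreover have "\<beta>'' = take (length \<gamma>) \<beta> @ R @
      take (length \<gamma> + length R2 + length Y2 - (length \<gamma> + length R2)) (drop (length \<gamma> + length R2) \<beta>) @ F @
      drop (length \<gamma> + length R2 + length Y2 + length F2) \<beta>"
    unfolding \<beta>''_def by (subst (1 2 3) 2) simp
  ultimately have "rf_step \<beta> \<beta>''" unfolding rf_step_def using B.wf wf rf R F by metis
  moreover have "\<exists>\<delta>. \<alpha> = (\<gamma> @ R1) @ \<delta>" using 1 by auto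
  moreover have "\<exists>\<delta>. \<beta>'' = (\<gamma> @ R1) @ \<delta>" by (simp add: \<beta>''_def R_def)
  ultimately show ?thesis using that[of \<beta>'' R1] expand w1 ea by simp
qed

end

section \<open>Building the chain\<close>

lemma common_prefix:
  "\<exists>\<delta> xs' ys'. xs = \<delta> @ xs' \<and> ys = \<delta> @ ys' \<and> (xs' = [] \<or> ys' = [] \<or> hd xs' \<noteq> hd ys')"
proof (induction xs arbitrary: ys)
  case (Cons x xs)
  show ?case
  proof (cases "ys \<noteq> [] \<and> hd ys = x")
    case True
    then obtain zs where "ys = x # zs" by (cases ys) auto
    moreover obtain \<delta> xs' ys' where "xs = \<delta> @ xs'" "zs = \<delta> @ ys'" "xs' = [] \<or> ys' = [] \<or> hd xs' \<noteq> hd ys'"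
      using Cons by blast
    ultimately show ?thesis by (intro exI[of _ "x # \<delta>"] exI[of _ xs'] exI[of _ ys']) auto
  next
    case False
    then show ?thesis by (intro exI[of _ "[]"] exI[of _ "x # xs"] exI[of _ ys]) auto
  qed
qed simp

lemma rf_related_sym: "rf_related\<^sup>*\<^sup>* \<alpha> \<beta> \<Longrightarrow> rf_related\<^sup>*\<^sup>* \<beta> \<alpha>"
  by (metis rf_related_def sympI sympD symp_rtranclp)

text \<open>The measure counts the pushes beyond a common prefix. Whichever sequence has the longer
  minimal interval is rewritten, so the two may exchange roles from one step to the next.\<close>

lemma same_path_connected:
  assumes "same_path \<alpha> \<beta>" "\<alpha> = \<gamma> @ \<alpha>'" "\<beta> = \<gamma> @ \<beta>'"
  shows "rf_related\<^sup>*\<^sup>* \<alpha> \<beta>"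
  using assms
proof (induction "weight push_size \<alpha> - weight push_size \<gamma>" arbitrary: \<alpha> \<beta> \<gamma> \<alpha>' \<beta>' rule: less_induct)
  case less
  interpret same_path \<alpha> \<beta> by (rule less.prems(1))
  obtain \<delta> xs ys where \<delta>: "\<alpha>' = \<delta> @ xs" "\<beta>' = \<delta> @ ys" "xs = [] \<or> ys = [] \<or> hd xs \<noteq> hd ys"
    using common_prefix by blast
  define \<gamma>' where "\<gamma>' = \<gamma> @ \<delta>"
  have \<alpha>: "\<alpha> = \<gamma>' @ xs" and \<beta>: "\<beta> = \<gamma>' @ ys" using less.prems \<delta> by (auto simp: \<gamma>'_def)
  have ex: "expand xs = expand ys" using expand_eq unfolding \<alpha> \<beta> by simp
  have closer: "weight push_size \<alpha> - weight push_size (\<gamma>' @ R) < weight push_size \<alpha> - weight push_size \<gamma>"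
    if "0 < weight push_size R" "\<exists>\<delta>. \<alpha> = (\<gamma>' @ R) @ \<delta>" for R
    using that by (auto simp: \<gamma>'_def)
  show ?case
  proof (cases "xs = [] \<or> ys = []")
    case True
    have "ys = []" if "xs = []"
      using ex that B.unit_ops_nonempty[of "hd ys"] by (cases ys) (auto simp: \<beta>)
    moreover have "xs = []" if "ys = []"
      using ex that A.unit_ops_nonempty[of "hd xs"] by (cases xs) (auto simp: \<alpha>)
    ultimately have "\<alpha> = \<beta>" using True \<alpha> \<beta> by auto
    then show ?thesis by simp
  next
    case False
    then obtain x xs' y ys' where xy: "xs = x # xs'" "ys = y # ys'" "x \<noteq> y"
      using \<delta>(3) by (cases xs; cases ys) auto
    have ne: "unit_ops x \<noteq> []" "unit_ops y \<noteq> []"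
      using A.unit_ops_nonempty[of x] B.unit_ops_nonempty[of y] xy by (auto simp: \<alpha> \<beta>)
    \<comment> \<open>The paths agree, so the first operations that differ are of the same kind and
      differ only in size.\<close>
    have "hd (unit_ops x) = hd (unit_ops y)" using ex ne xy by (metis expand_simps(2) hd_append2)
    then consider s s' where "x = Push s" "y = Push s'" | t t' where "x = Pop t" "y = Pop t'"
      using ne by (cases x; cases y) auto
    then show ?thesis
    proof cases
      case 2
      then have "t = t'" using no_first_pop_difference \<alpha> \<beta> xy by blast
      then show ?thesis using 2 xy by simp
    next
      case 1
      have \<alpha>: "\<alpha> = \<gamma>' @ Push s # xs'" and \<beta>: "\<beta> = \<gamma>' @ Push s' # ys'" and ss: "s \<noteq> s'"
        using \<alpha> \<beta> xy 1 by auto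
      define e where e: "e = weight push_size \<gamma>'"
      obtain c where c: "A.cut e c" "B.cut e c" using common_cut_at_push(3)[OF \<alpha> \<beta> ss e] by blast
      obtain a where a: "A.cut e a" "\<And>c. c < a \<Longrightarrow> \<not> A.cut e c" using c(1) by (metis exists_least_iff)
      obtain b where b: "B.cut e b" "\<And>c. c < b \<Longrightarrow> \<not> B.cut e c" using c(2) by (metis exists_least_iff)
      show ?thesis
      proof (cases "a \<le> b")
        case True
        obtain \<beta>'' R where r: "rf_step \<beta> \<beta>''" "expand \<beta>'' = expand \<beta>" "0 < weight push_size R"
          "\<exists>\<delta>. \<alpha> = (\<gamma>' @ R) @ \<delta>" "\<exists>\<delta>. \<beta>'' = (\<gamma>' @ R) @ \<delta>"
          by (rule replace_rise_fall[OF \<alpha> \<beta> ss e a(1) b(1) b(2) True])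
        have "same_path \<alpha> \<beta>''"
          using r expand_eq perm_eq by unfold_locales (auto simp: rf_step_def)
        then have "rf_related\<^sup>*\<^sup>* \<alpha> \<beta>''" using less.hyps[OF closer[OF r(3,4)]] r(4,5) by blast
        moreover have "rf_related \<beta>'' \<beta>" using r(1) by (simp add: rf_related_def)
        ultimately show ?thesis by (rule rtranclp.rtrancl_into_rtrancl)
      next
        case False
        then have le: "b \<le> a" by simp
        obtain \<alpha>'' R where r: "rf_step \<alpha> \<alpha>''" "expand \<alpha>'' = expand \<alpha>" "0 < weight push_size R"
          "\<exists>\<delta>. \<beta> = (\<gamma>' @ R) @ \<delta>" "\<exists>\<delta>. \<alpha>'' = (\<gamma>' @ R) @ \<delta>"
          by (rule same_path.replace_rise_fall[OF sym \<beta> \<alpha> ss[symmetric] e b(1) a(1) a(2) le])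
        have sp: "same_path \<beta> \<alpha>''"
          using r expand_eq perm_eq by unfold_locales (auto simp: rf_step_def)
        \<comment> \<open>Since \<open>\<alpha>\<close> was rewritten, the induction hypothesis is
          used with \<open>\<beta>\<close> in first place, and the chain is reversed
          afterwards.\<close>
        have "weight push_size \<beta> - weight push_size (\<gamma>' @ R) < weight push_size \<alpha> - weight push_size \<gamma>"
          using r(3,4) n_eq by (auto simp: \<gamma>'_def)
        then have "rf_related\<^sup>*\<^sup>* \<beta> \<alpha>''" using less.hyps[OF _ sp] r(4,5) by blast
        then have "rf_related\<^sup>*\<^sup>* \<alpha>'' \<beta>" by (rule rf_related_sym)
        moreover have "rf_related \<alpha> \<alpha>''" using r(1) by (simp add: rf_related_def)
        ultimately show ?thesis by (rule converse_rtranclp_into_rtranclp[rotated])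
      qed
    qed
  qed
qed

lemma reduced_same_path:
  assumes "equivalent \<alpha> \<beta>" "reduced \<alpha>" "reduced \<beta>"
  shows "same_path \<alpha> \<beta>"
proof -
  interpret A: wf_seq \<alpha> using assms by unfold_locales (simp add: equivalent_def)
  interpret B: wf_seq \<beta> using assms by unfold_locales (simp add: equivalent_def)
  have n: "B.n = A.n" and perm: "perm_of \<alpha> = perm_of \<beta>"
    using assms(1) by (auto simp: equivalent_def op_size_def)
  have "map (\<lambda>j. Suc (A.out_at j)) [0..<A.n] = map (\<lambda>j. Suc (B.out_at j)) [0..<A.n]"
    using perm unfolding A.perm_of_eq B.perm_of_eq n by simp
  then have out: "A.out_at j = B.out_at j" if "j < A.n" for j using that by simp
  have "pop_heights 0 \<alpha> = pop_heights 0 \<beta>"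
  proof (rule nth_equalityI)
    show "length (pop_heights 0 \<alpha>) = length (pop_heights 0 \<beta>)"
      using n A.weight_pop B.weight_pop by (simp add: length_pop_heights)
    fix j assume "j < length (pop_heights 0 \<alpha>)"
    then have ja: "j < weight pop_size \<alpha>" and jb: "j < weight pop_size \<beta>" and jn: "j < A.n"
      using n A.weight_pop B.weight_pop by (simp_all add: length_pop_heights)
    obtain k where k: "k < length \<alpha>" "A.QB k \<le> j" "j < A.QB (Suc k)" using ja by (rule locate_op)
    obtain l where l: "l < length \<beta>" "B.QB l \<le> j" "j < B.QB (Suc l)" using jb by (rule locate_op)
    have "A.out_at ` {..j} = B.out_at ` {..j}" using out jn by (intro image_cong) auto
    then have "A.PB k = B.PB l"
      using A.reduced_pop_height[OF assms(2) k] B.reduced_pop_height[OF assms(3) l] by simp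
    then show "pop_heights 0 \<alpha> ! j = pop_heights 0 \<beta> ! j"
      using pop_heights_nth[OF k, of 0] pop_heights_nth[OF l, of 0] by simp
  qed
  then have "expand \<alpha> = expand \<beta>"
    using pop_heights_inject[OF set_expand set_expand, of 0 \<alpha> \<beta>] n by (simp add: pop_heights_expand)
  then show ?thesis using perm by unfold_locales
qed

theorem mainTheorem13:
  fixes \<alpha> \<beta> :: "op list"
  assumes "well_formed \<alpha>" and "well_formed \<beta>" and "reduced \<alpha>" and "reduced \<beta>"
  shows "equivalent \<alpha> \<beta> \<longleftrightarrow> rf_related\<^sup>*\<^sup>* \<alpha> \<beta>"
proof
  assume "equivalent \<alpha> \<beta>"
  then have "same_path \<alpha> \<beta>" using reduced_same_path assms by blast
  then show "rf_related\<^sup>*\<^sup>* \<alpha> \<beta>" using same_path_connected[of \<alpha> \<beta> "[]"] by simp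
next
  assume "rf_related\<^sup>*\<^sup>* \<alpha> \<beta>"
  then have "perm_of \<alpha> = perm_of \<beta>"
    by (induction rule: rtranclp_induct) (auto simp: rf_related_def rf_step_def)
  \<comment> \<open>The size is the length of the produced permutation, so equal permutations force
    equal sizes.\<close>
  moreover have "length (perm_of \<alpha>) = op_size \<alpha>" "length (perm_of \<beta>) = op_size \<beta>"
    using wf_seq.length_perm_of[OF wf_seq.intro] assms by (auto simp: op_size_def)
  ultimately show "equivalent \<alpha> \<beta>" using assms by (simp add: equivalent_def)
qed

end
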